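(* Let $G$ be a finite solvable WSM-group and let $x \in G$ be a non-vanishing element of $G$. Then $x \in \mathrm{F}(G)$, where $\mathrm{F}(G)$ denotes the Fitting subgroup of $G$.
   Context: All groups are finite. $\mathrm{Irr}(G)$ denotes the set of all irreducible complex characters of $G$. An element $x\in G$ is a non-vanishing element of $G$ if $\chi(x)\neq 0$ for all $\chi\in\mathrm{Irr}(G)$. A maximal subgroup of a group is a proper subgroup not properly contained in any other proper subgroup. For a proper subgroup $H$ of $G$, let $\mathrm{Max}(G,H)$ be the set of all maximal subgroups of $G$ containing $H$. A proper subgroup $H$ of $G$ is a second maximal subgroup of $G$ if $H$ is a maximal subgroup of every member of $\mathrm{Max}(G,H)$. A proper subgroup $H$ of $G$ is a weak second maximal subgroup of $G$ if $H$ is a maximal subgroup of some member of $\mathrm{Max}(G,H)$. A group $G$ is a WSM-group if every weak second maximal subgroup of $G$ is a second maximal subgroup of $G$. *)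

theory Defs
  imports "HOL-Algebra.Algebra" "Jordan_Normal_Form.VS_Connect"
begin

definition mat_trace :: "'a :: comm_monoid_add mat \<Rightarrow> 'a" where
  "mat_trace A = (\<Sum>i<dim_row A. A $$ (i, i))"

text \<open>\<open>units_of (ring_mat TYPE(complex) n ())\<close> is the general linear group of degree \<open>n\<close>
  over the complex numbers.\<close>

definition matrix_representation :: "('a, 'b) monoid_scheme \<Rightarrow> nat \<Rightarrow> ('a \<Rightarrow> complex mat) \<Rightarrow> bool" where
  "matrix_representation G n \<rho> \<longleftrightarrow> \<rho> \<in> hom G (units_of (ring_mat TYPE(complex) n ()))"

definition invariant_subspace ::
    "('a, 'b) monoid_scheme \<Rightarrow> nat \<Rightarrow> ('a \<Rightarrow> complex mat) \<Rightarrow> complex vec set \<Rightarrow> bool" where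
  "invariant_subspace G n \<rho> W \<longleftrightarrow>
     VectorSpace.subspace class_ring W (module_vec TYPE(complex) n) \<and>
     (\<forall>g\<in>carrier G. \<forall>w\<in>W. \<rho> g *\<^sub>v w \<in> W)"

definition irreducible_representation ::
    "('a, 'b) monoid_scheme \<Rightarrow> nat \<Rightarrow> ('a \<Rightarrow> complex mat) \<Rightarrow> bool" where
  "irreducible_representation G n \<rho> \<longleftrightarrow>
     matrix_representation G n \<rho> \<and> n > 0 \<and>
     (\<forall>W. invariant_subspace G n \<rho> W \<longrightarrow> W = {0\<^sub>v n} \<or> W = carrier_vec n)"

text \<open>Characters are functions on \<open>carrier G\<close>; restricting them makes their values
  outside the carrier irrelevant.\<close>

definition Irr :: "('a, 'b) monoid_scheme \<Rightarrow> ('a \<Rightarrow> complex) set" where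
  "Irr G = {\<lambda>g\<in>carrier G. mat_trace (\<rho> g) | n \<rho>. irreducible_representation G n \<rho>}"

definition non_vanishing :: "('a, 'b) monoid_scheme \<Rightarrow> 'a \<Rightarrow> bool" where
  "non_vanishing G x \<longleftrightarrow> x \<in> carrier G \<and> (\<forall>\<chi>\<in>Irr G. \<chi> x \<noteq> 0)"

definition proper_subgroup :: "'a set \<Rightarrow> ('a, 'b) monoid_scheme \<Rightarrow> bool" where
  "proper_subgroup H G \<longleftrightarrow> subgroup H G \<and> H \<noteq> carrier G"

definition maximal_subgroup :: "'a set \<Rightarrow> ('a, 'b) monoid_scheme \<Rightarrow> bool" where
  "maximal_subgroup H G \<longleftrightarrow>
     proper_subgroup H G \<and> \<not> (\<exists>K. proper_subgroup K G \<and> H \<subset> K)"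

definition Max_over :: "('a, 'b) monoid_scheme \<Rightarrow> 'a set \<Rightarrow> 'a set set" where
  "Max_over G H = {M. maximal_subgroup M G \<and> H \<subseteq> M}"

definition second_maximal :: "'a set \<Rightarrow> ('a, 'b) monoid_scheme \<Rightarrow> bool" where
  "second_maximal H G \<longleftrightarrow>
     proper_subgroup H G \<and> (\<forall>M\<in>Max_over G H. maximal_subgroup H (G\<lparr>carrier := M\<rparr>))"

definition weak_second_maximal :: "'a set \<Rightarrow> ('a, 'b) monoid_scheme \<Rightarrow> bool" where
  "weak_second_maximal H G \<longleftrightarrow>
     proper_subgroup H G \<and> (\<exists>M\<in>Max_over G H. maximal_subgroup H (G\<lparr>carrier := M\<rparr>))"

definition WSM_group :: "('a, 'b) monoid_scheme \<Rightarrow> bool" where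
  "WSM_group G \<longleftrightarrow> group G \<and> (\<forall>H. weak_second_maximal H G \<longrightarrow> second_maximal H G)"

definition commutator_subgroup ::
    "('a, 'b) monoid_scheme \<Rightarrow> 'a set \<Rightarrow> 'a set \<Rightarrow> 'a set" where
  "commutator_subgroup G H K =
     generate G (\<Union>h\<in>H. \<Union>k\<in>K. {h \<otimes>\<^bsub>G\<^esub> k \<otimes>\<^bsub>G\<^esub> inv\<^bsub>G\<^esub> h \<otimes>\<^bsub>G\<^esub> inv\<^bsub>G\<^esub> k})"

text \<open>Nilpotency: the lower central series reaches the trivial subgroup.\<close>

definition nilpotent :: "('a, 'b) monoid_scheme \<Rightarrow> bool" where
  "nilpotent G \<longleftrightarrow>
     (\<exists>n. ((\<lambda>H. commutator_subgroup G H (carrier G)) ^^ n) (carrier G) = {\<one>\<^bsub>G\<^esub>})"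

text \<open>The subgroup generated by all nilpotent normal subgroups; for finite \<open>G\<close> it is itself
  nilpotent (Fitting), hence the largest nilpotent normal subgroup.\<close>

definition Fitting :: "('a, 'b) monoid_scheme \<Rightarrow> 'a set" where
  "Fitting G = generate G (\<Union>{N. N \<lhd> G \<and> nilpotent (G\<lparr>carrier := N\<rparr>)})"

end

theory Submission
  imports Defs "HOL-Library.Function_Algebras"
begin

text \<open>
  Let \<open>Y\<close> be the normal closure of \<open>x\<close>. If \<open>x\<close> is outside the Fitting subgroup, no term of the
  series \<open>Y\<close>, \<open>[Y, Y]\<close>, \<open>[[Y, Y], Y]\<close> and so on is trivial. Solvability, the WSM property and being
  non-vanishing all pass to quotients, so one may divide by a normal subgroup that is maximal among
  those containing no term of the series. In the quotient the last term \<open>V\<close> of the series is the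
  unique minimal normal subgroup; it is abelian, not centralized by \<open>Y\<close>, and \<open>Y/V\<close> is nilpotent. A
  Frattini argument with the Sylow subgroups of \<open>Y\<close> shows that \<open>V\<close> has a complement \<open>M\<close> which is a
  maximal subgroup (\<open>maximal_complement\<close>).

  The WSM property enters once: if \<open>H\<close> is maximal in \<open>M\<close>, then it is maximal in every maximal
  subgroup containing \<open>VH\<close>, which forces \<open>V\<close> to be irreducible under \<open>H\<close>
  (\<open>irreducible_under_maximal\<close>). Thus \<open>V\<close> is a primitive \<open>M\<close>-module in a strong sense, and so
  an abelian normal subgroup \<open>A\<close> of \<open>M\<close> acts on \<open>V\<close> without fixed points
  (\<open>abelian_normal_fixed_point_free\<close>). As a noncyclic group of order \<open>q^2\<close> cannot act in this way,
  every element of prime order of \<open>A\<close> generates a normal subgroup of \<open>M\<close>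
  (\<open>prime_order_conjugate\<close>).

  Vanishing characters come from one criterion (\<open>vanishing_if_coset_conjugate\<close>): if \<open>K < B\<close> are
  normal and every \<open>b x\<close> with \<open>b \<in> B\<close> is conjugate to \<open>x\<close> modulo \<open>K\<close>, then some irreducible
  character vanishes at \<open>x\<close>. Indeed the functions on \<open>G\<close> that are invariant under \<open>K\<close> and killed by
  \<open>\<Sum>b\<in>B. b\<close> form a nonzero invariant space; on an irreducible subspace of it the trace of \<open>x\<close> is the
  average of the equal traces of the \<open>b x\<close>, which is zero.

  To apply the criterion, let \<open>W\<close> be the last term of the series not contained in \<open>V\<close>; then
  \<open>W \<inter> M\<close> is abelian and normal in \<open>M\<close>. If \<open>W = Y\<close>, then \<open>x\<close> acts on \<open>V\<close> without fixed points, the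
  map \<open>u \<mapsto> [u, x]\<close> is a bijection of \<open>V\<close>, and \<open>K = 1\<close>, \<open>B = V\<close> serve. Otherwise the preceding term
  contains an \<open>f\<close> with \<open>z = [f, x] \<in> W - V\<close>; modulo \<open>V\<close>, conjugation by \<open>f^k\<close> takes \<open>x\<close> to \<open>z^k x\<close>.
  After replacing \<open>f\<close> by a power, \<open>z\<close> has prime order modulo \<open>V\<close>, and \<open>K = V\<close>, \<open>B = V\<langle>z\<rangle>\<close> serve
  (\<open>vanishing_if_outside_minimal\<close>).
\<close>

section \<open>Matrix representations from invariant spaces of functions\<close>

text \<open>Complex-valued functions with pointwise operations. They serve as the ambient space of the
  regular representation.\<close>
interpretation fun_space: vector_space "\<lambda>(c::complex) (f::'c \<Rightarrow> complex) x. c * f x"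
  by unfold_locales (auto simp: fun_eq_iff algebra_simps)

lemma subspace_module_vec_iff:
  "VectorSpace.subspace class_ring W (module_vec TYPE(complex) n) \<longleftrightarrow>
     W \<subseteq> carrier_vec n \<and> 0\<^sub>v n \<in> W \<and> (\<forall>v\<in>W. \<forall>w\<in>W. v + w \<in> W) \<and> (\<forall>c. \<forall>v\<in>W. c \<cdot>\<^sub>v v \<in> W)"
proof -
  interpret vec_space "TYPE(complex)" n .
  have "vectorspace class_ring (module_vec TYPE(complex) n)" by unfold_locales
  moreover have "Module.module class_ring (module_vec TYPE(complex) n)" by unfold_locales
  ultimately show ?thesis
    by (auto simp: VectorSpace.subspace_def submodule_def module_vec_def)
qed

lemma hom_units_of_ring_mat:
  fixes G (structure)
  assumes "group G"
    and car: "\<And>g. g \<in> carrier G \<Longrightarrow> \<rho> g \<in> carrier_mat n n"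
    and mult: "\<And>g h. g \<in> carrier G \<Longrightarrow> h \<in> carrier G \<Longrightarrow> \<rho> (g \<otimes>\<^bsub>G\<^esub> h) = \<rho> g * \<rho> h"
    and one: "\<rho> \<one>\<^bsub>G\<^esub> = 1\<^sub>m n"
  shows "matrix_representation G n \<rho>"
proof -
  interpret group G by fact
  have "\<rho> g \<in> Units (ring_mat TYPE(complex) n ())" if g: "g \<in> carrier G" for g
  proof -
    have "\<rho> g * \<rho> (inv\<^bsub>G\<^esub> g) = 1\<^sub>m n" "\<rho> (inv\<^bsub>G\<^esub> g) * \<rho> g = 1\<^sub>m n"
      using g mult[of g "inv g"] mult[of "inv g" g] one by auto
    thus ?thesis using car[OF g] car[OF inv_closed[OF g]]
      by (auto simp: Units_def ring_mat_def)
  qed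
  thus ?thesis unfolding matrix_representation_def hom_def
    by (auto simp: units_of_def mult ring_mat_def)
qed

lemma sum_fun_app: "sum f A x = (\<Sum>a\<in>A. f a x)" for f :: "'i \<Rightarrow> 'c \<Rightarrow> complex"
  by (induction A rule: infinite_finite_induct) auto

text \<open>An irreducible finite-dimensional representation on a space \<open>U\<close> of functions can be written in
  matrices with respect to a basis of \<open>U\<close>. The matrices inherit from the operators coincidences
  and vanishing sums.\<close>
lemma irreducible_matrix_representation:
  fixes G (structure) and T :: "'a \<Rightarrow> ('c \<Rightarrow> complex) \<Rightarrow> 'c \<Rightarrow> complex"
  assumes "group G" and "finite S"
    and sub: "fun_space.subspace U" and US: "U \<subseteq> fun_space.span S" and nz: "U \<noteq> {0}"
    and closed: "\<And>g f. g \<in> carrier G \<Longrightarrow> f \<in> U \<Longrightarrow> T g f \<in> U"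
    and add: "\<And>g f f'. T g (f + f') = T g f + T g f'"
    and scale: "\<And>g c f. T g (\<lambda>x. c * f x) = (\<lambda>x. c * T g f x)"
    and mult: "\<And>g h f. g \<in> carrier G \<Longrightarrow> h \<in> carrier G \<Longrightarrow> f \<in> U \<Longrightarrow> T (g \<otimes>\<^bsub>G\<^esub> h) f = T g (T h f)"
    and one: "\<And>f. f \<in> U \<Longrightarrow> T \<one>\<^bsub>G\<^esub> f = f"
    and irr: "\<And>U'. fun_space.subspace U' \<Longrightarrow> U' \<subseteq> U \<Longrightarrow> (\<And>g f. g \<in> carrier G \<Longrightarrow> f \<in> U' \<Longrightarrow> T g f \<in> U')
              \<Longrightarrow> U' = {0} \<or> U' = U"
  obtains n \<rho> where "irreducible_representation G n \<rho>"
    and "\<And>g h. (\<And>f. f \<in> U \<Longrightarrow> T g f = T h f) \<Longrightarrow> \<rho> g = \<rho> h"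
    and "\<And>A i j. A \<subseteq> carrier G \<Longrightarrow> (\<And>f. f \<in> U \<Longrightarrow> (\<Sum>a\<in>A. T a f) = 0) \<Longrightarrow> i < n \<Longrightarrow> j < n
           \<Longrightarrow> (\<Sum>a\<in>A. \<rho> a $$ (i, j)) = 0"
proof -
  interpret group G by fact
  obtain B where B: "B \<subseteq> U" "fun_space.independent B" "U \<subseteq> fun_space.span B"
    using fun_space.basis_exists[of U] by metis
  have span: "fun_space.span B = U"
    by (intro equalityI B(3) fun_space.span_minimal[OF B(1) sub])
  have finB: "finite B"
    using fun_space.independent_span_bound[OF assms(2) B(2) order.trans[OF B(1) US]] by simp
  obtain bs where bs: "set bs = B" "distinct bs" using finite_distinct_list[OF finB] by auto
  define n where "n = length bs"
  have bsU: "bs ! j \<in> U" if "j < n" for j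
    using that bs B by (auto simp: n_def)
  \<comment> \<open>coordinates with respect to the basis, and below the isomorphism \<open>\<phi>\<close> in the other direction\<close>
  define R where "R v i = fun_space.representation B v (bs ! i)" for v i
  have R_add: "R (v + w) i = R v i + R w i" if "v \<in> U" "w \<in> U" for v w i
    using fun_space.representation_add[OF B(2)] that span by (simp add: R_def)
  have R_scale: "R (\<lambda>x. c * v x) i = c * R v i" if "v \<in> U" for c v i
    using fun_space.representation_scale[OF B(2)] that span by (simp add: R_def)
  have R_sum: "R (sum v I) i = (\<Sum>k\<in>I. R (v k) i)" if "\<And>k. k \<in> I \<Longrightarrow> v k \<in> U" for v i and I :: "'d set"
    using fun_space.representation_sum[OF B(2), of I v] that span by (simp add: R_def)
  have R_basis: "R (bs ! j) i = (if i = j then 1 else 0)" if "i < n" "j < n" for i j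
    using that fun_space.representation_basis[OF B(2), of "bs ! j"] bs
    by (auto simp: R_def n_def nth_eq_iff_index_eq)
  have expand: "v = (\<Sum>j<n. (\<lambda>x. R v j * (bs ! j) x))" if "v \<in> U" for v
  proof -
    have "v = (\<Sum>b\<in>B. (\<lambda>x. fun_space.representation B v b * b x))"
      using fun_space.sum_representation_eq[OF B(2) _ finB order.refl] that span by simp
    also have "\<dots> = (\<Sum>j<n. (\<lambda>x. R v j * (bs ! j) x))"
      unfolding R_def n_def
      by (rule sum.reindex_bij_betw[OF bij_betw_nth[OF bs(2) refl bs(1)[symmetric]], symmetric])
    finally show ?thesis .
  qed
  have scaleU: "(\<lambda>x. c * v x) \<in> U" if "v \<in> U" for c v
    using fun_space.subspace_scale[OF sub that] .
  have sumU: "sum v I \<in> U" if "\<And>k. k \<in> I \<Longrightarrow> v k \<in> U" for v and I :: "nat set"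
    using fun_space.subspace_sum[OF sub, of I v] that by simp
  have T_zero: "T g 0 = 0" for g using scale[of g 0 0] by (simp add: zero_fun_def)
  have T_sum: "T g (sum v I) = (\<Sum>k\<in>I. T g (v k))" for g v and I :: "nat set"
    by (induction I rule: infinite_finite_induct) (simp_all only: sum.infinite sum.empty sum.insert T_zero add not_False_eq_True if_False)
  define \<rho> where "\<rho> g = mat n n (\<lambda>(i,j). R (T g (bs ! j)) i)" for g
  have \<rho>_car: "\<rho> g \<in> carrier_mat n n" for g by (simp add: \<rho>_def)
  have key: "R (T g v) i = (\<Sum>j<n. \<rho> g $$ (i,j) * R v j)" if g: "g \<in> carrier G" and v: "v \<in> U" and i: "i < n" for g v i
  proof -
    have "T g v = (\<Sum>j<n. (\<lambda>x. R v j * T g (bs ! j) x))"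
      by (subst expand[OF v]) (simp add: T_sum scale)
    hence "R (T g v) i = (\<Sum>j<n. R v j * R (T g (bs ! j)) i)"
      using R_sum[of "{..<n}" "\<lambda>j x. R v j * T g (bs ! j) x"] closed[OF g bsU] by (simp add: scaleU R_scale)
    thus ?thesis using i by (simp add: \<rho>_def mult.commute)
  qed
  have \<rho>_mult: "\<rho> (g \<otimes> h) = \<rho> g * \<rho> h" if "g \<in> carrier G" "h \<in> carrier G" for g h
  proof (rule eq_matI)
    fix i j assume "i < dim_row (\<rho> g * \<rho> h)" "j < dim_col (\<rho> g * \<rho> h)"
    hence ij: "i < n" "j < n" using \<rho>_car by (auto simp: \<rho>_def)
    have "\<rho> (g \<otimes> h) $$ (i,j) = R (T g (T h (bs ! j))) i"
      using ij that mult bsU by (simp add: \<rho>_def)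
    also have "\<dots> = (\<Sum>k<n. \<rho> g $$ (i,k) * R (T h (bs ! j)) k)"
      using key that ij bsU closed by simp
    also have "\<dots> = (\<rho> g * \<rho> h) $$ (i,j)"
      using ij by (simp add: \<rho>_def scalar_prod_def lessThan_atLeast0)
    finally show "\<rho> (g \<otimes> h) $$ (i,j) = (\<rho> g * \<rho> h) $$ (i,j)" .
  qed (auto simp: \<rho>_def)
  have \<rho>_one: "\<rho> \<one> = 1\<^sub>m n"
    by (rule eq_matI) (auto simp: \<rho>_def one bsU R_basis)
  have rep: "matrix_representation G n \<rho>"
    using hom_units_of_ring_mat[OF assms(1) \<rho>_car \<rho>_mult \<rho>_one] .
  define \<phi> where "\<phi> w = (\<Sum>j<n. (\<lambda>x. w $ j * (bs ! j) x))" for w :: "complex vec"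
  have \<phi>U: "\<phi> w \<in> U" for w unfolding \<phi>_def by (intro sumU scaleU bsU) auto
  have R_\<phi>: "R (\<phi> w) i = w $ i" if "i < n" for w i
  proof -
    have "R (\<phi> w) i = (\<Sum>j<n. w $ j * R (bs ! j) i)"
      unfolding \<phi>_def using R_sum[of "{..<n}" "\<lambda>j x. w $ j * (bs ! j) x"] bsU by (simp add: scaleU R_scale)
    also have "\<dots> = (\<Sum>j<n. if j = i then w $ j else 0)"
      by (intro sum.cong refl) (use that R_basis in auto)
    finally show ?thesis using that by simp
  qed
  have \<phi>_R: "\<phi> (vec n (R v)) = v" if "v \<in> U" for v
    by (subst (2) expand[OF that]) (simp add: \<phi>_def)
  have vec_R_\<phi>: "vec n (R (\<phi> w)) = w" if "w \<in> carrier_vec n" for w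
    using that by (intro eq_vecI) (auto simp: R_\<phi>)
  have \<phi>_add: "\<phi> (v + w) = \<phi> v + \<phi> w" if "v \<in> carrier_vec n" "w \<in> carrier_vec n" for v w
  proof
    fix x
    have "\<phi> u x = (\<Sum>j<n. u $ j * (bs ! j) x)" for u by (simp add: \<phi>_def sum_fun_app)
    thus "\<phi> (v + w) x = (\<phi> v + \<phi> w) x" using that by (simp add: sum.distrib distrib_right)
  qed
  have \<phi>_scale: "\<phi> (c \<cdot>\<^sub>v w) = (\<lambda>x. c * \<phi> w x)" if "w \<in> carrier_vec n" for c w
  proof
    fix x
    have "\<phi> u x = (\<Sum>j<n. u $ j * (bs ! j) x)" for u by (simp add: \<phi>_def sum_fun_app)
    thus "\<phi> (c \<cdot>\<^sub>v w) x = c * \<phi> w x" using that by (simp add: sum_distrib_left mult.assoc)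
  qed
  have \<phi>_T: "\<phi> (\<rho> g *\<^sub>v w) = T g (\<phi> w)" if g: "g \<in> carrier G" and w: "w \<in> carrier_vec n" for g w
  proof -
    have "\<rho> g *\<^sub>v w = vec n (R (T g (\<phi> w)))"
    proof (rule eq_vecI)
      fix i assume "i < dim_vec (vec n (R (T g (\<phi> w))))"
      hence i: "i < n" by simp
      have "R (T g (\<phi> w)) i = (\<Sum>j<n. \<rho> g $$ (i,j) * w $ j)"
        using key[OF g \<phi>U i] R_\<phi> by simp
      thus "(\<rho> g *\<^sub>v w) $ i = vec n (R (T g (\<phi> w))) $ i"
        using i w by (simp add: \<rho>_def scalar_prod_def lessThan_atLeast0)
    qed (simp add: \<rho>_def)
    thus ?thesis using \<phi>_R closed[OF g \<phi>U] by simp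
  qed
  have "n > 0"
  proof (rule ccontr)
    assume "\<not> n > 0"
    hence "U = fun_space.span {}" using span bs by (auto simp: n_def)
    thus False using nz by simp
  qed
  moreover have "W = {0\<^sub>v n} \<or> W = carrier_vec n" if "invariant_subspace G n \<rho> W" for W
  proof -
    have W: "W \<subseteq> carrier_vec n" "0\<^sub>v n \<in> W" "\<And>v w. v \<in> W \<Longrightarrow> w \<in> W \<Longrightarrow> v + w \<in> W"
      "\<And>c v. v \<in> W \<Longrightarrow> c \<cdot>\<^sub>v v \<in> W" "\<And>g w. g \<in> carrier G \<Longrightarrow> w \<in> W \<Longrightarrow> \<rho> g *\<^sub>v w \<in> W"
      using that by (auto simp: invariant_subspace_def subspace_module_vec_iff)
    have zero: "\<phi> (0\<^sub>v n) = 0" by (simp add: \<phi>_def fun_eq_iff sum_fun_app)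
    have "fun_space.subspace (\<phi> ` W)"
      unfolding fun_space.subspace_def
    proof (intro conjI ballI allI)
      show "0 \<in> \<phi> ` W" using W(2) zero by (metis imageI)
    next
      fix a b assume "a \<in> \<phi> ` W" "b \<in> \<phi> ` W"
      then obtain v w where "v \<in> W" "w \<in> W" "a = \<phi> v" "b = \<phi> w" by auto
      thus "a + b \<in> \<phi> ` W" using \<phi>_add[of v w] W by (metis imageI subsetD)
    next
      fix c a assume "a \<in> \<phi> ` W"
      then obtain v where "v \<in> W" "a = \<phi> v" by auto
      thus "(\<lambda>x. c * a x) \<in> \<phi> ` W" using \<phi>_scale[of v c] W by (metis imageI subsetD)
    qed
    moreover have "\<phi> ` W \<subseteq> U" using \<phi>U by auto
    moreover have "T g f \<in> \<phi> ` W" if g: "g \<in> carrier G" and f: "f \<in> \<phi> ` W" for g f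
    proof -
      obtain w where w: "w \<in> W" "f = \<phi> w" using f by auto
      hence "T g f = \<phi> (\<rho> g *\<^sub>v w)" using \<phi>_T[OF g] W(1) by auto
      thus ?thesis using W(5)[OF g w(1)] by simp
    qed
    ultimately have "\<phi> ` W = {0} \<or> \<phi> ` W = U" by (rule irr)
    thus ?thesis
    proof
      assume 1: "\<phi> ` W = {0}"
      have "w = 0\<^sub>v n" if "w \<in> W" for w
      proof -
        have "\<phi> w = \<phi> (0\<^sub>v n)" using imageI[OF that, of \<phi>] unfolding 1 zero by (rule singletonD)
        hence "vec n (R (\<phi> w)) = vec n (R (\<phi> (0\<^sub>v n)))" by (rule arg_cong)
        thus ?thesis unfolding vec_R_\<phi>[OF subsetD[OF W(1) that]] vec_R_\<phi>[OF zero_carrier_vec] .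
      qed
      hence "W = {0\<^sub>v n}" using W(2) by blast
      thus ?thesis by (rule disjI1)
    next
      assume 2: "\<phi> ` W = U"
      have "w \<in> W" if w: "w \<in> carrier_vec n" for w
      proof -
        have "\<phi> w \<in> \<phi> ` W" unfolding 2 by (rule \<phi>U)
        then obtain v where v: "v \<in> W" "\<phi> w = \<phi> v" by (rule imageE)
        have "vec n (R (\<phi> w)) = vec n (R (\<phi> v))" using v(2) by (rule arg_cong)
        thus ?thesis unfolding vec_R_\<phi>[OF w] vec_R_\<phi>[OF subsetD[OF W(1) v(1)]] using v(1) by simp
      qed
      hence "W = carrier_vec n" using W(1) by blast
      thus ?thesis by (rule disjI2)
    qed
  qed
  ultimately have 1: "irreducible_representation G n \<rho>"
    using rep by (simp add: irreducible_representation_def)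
  have 2: "\<rho> g = \<rho> h" if "\<And>f. f \<in> U \<Longrightarrow> T g f = T h f" for g h
    by (rule eq_matI) (auto simp: \<rho>_def that bsU)
  have 3: "(\<Sum>a\<in>A. \<rho> a $$ (i, j)) = 0"
    if A: "A \<subseteq> carrier G" "\<And>f. f \<in> U \<Longrightarrow> (\<Sum>a\<in>A. T a f) = 0" and ij: "i < n" "j < n" for A i j
  proof -
    have "(\<Sum>a\<in>A. \<rho> a $$ (i, j)) = (\<Sum>a\<in>A. R (T a (bs ! j)) i)"
      using ij by (simp add: \<rho>_def)
    also have "\<dots> = R (\<Sum>a\<in>A. T a (bs ! j)) i"
      using R_sum[of A "\<lambda>a. T a (bs ! j)"] A(1) closed bsU ij by (metis subsetD)
    also have "\<dots> = 0"
      using A(2) bsU ij by (simp add: R_def fun_space.representation_zero)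
    finally show ?thesis .
  qed
  show ?thesis by (rule that[OF 1 2 3])
qed

lemma mat_trace_mult:
  assumes "A \<in> carrier_mat n n" "B \<in> carrier_mat n n"
  shows "mat_trace (A * B) = (\<Sum>i<n. \<Sum>j<n. A $$ (i,j) * B $$ (j,i))"
  using assms by (auto simp: mat_trace_def scalar_prod_def lessThan_atLeast0 intro!: sum.cong)

lemma mat_trace_commute:
  fixes A B :: "complex mat"
  assumes "A \<in> carrier_mat n n" "B \<in> carrier_mat n n"
  shows "mat_trace (A * B) = mat_trace (B * A)"
  unfolding mat_trace_mult[OF assms] mat_trace_mult[OF assms(2,1)]
  by (subst sum.swap) (simp add: mult.commute)

lemma matrix_representationD:
  fixes G (structure)
  assumes "matrix_representation G n \<rho>"
  shows "g \<in> carrier G \<Longrightarrow> \<rho> g \<in> carrier_mat n n"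
    and "g \<in> carrier G \<Longrightarrow> h \<in> carrier G \<Longrightarrow> \<rho> (g \<otimes> h) = \<rho> g * \<rho> h"
  using assms by (auto simp: matrix_representation_def hom_def units_of_def Units_def ring_mat_def Pi_def)

lemma (in group) mult_cancel:
  assumes "a \<in> carrier G" "b \<in> carrier G"
  shows "inv a \<otimes> (a \<otimes> b) = b" "a \<otimes> (inv a \<otimes> b) = b"
  using assms by (simp_all add: m_assoc[symmetric])

lemmas (in group) word_simps = m_assoc inv_mult_group mult_cancel

lemma (in group) subgroup_mult_mem_iff:
  assumes "subgroup L G" "k \<in> L" "h \<in> carrier G"
  shows "k \<otimes> h \<in> L \<longleftrightarrow> h \<in> L"
proof
  interpret L: subgroup L G by fact
  have k: "k \<in> carrier G" using assms(2) by simp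
  assume "k \<otimes> h \<in> L"
  hence "inv k \<otimes> (k \<otimes> h) \<in> L" using assms(2) by simp
  thus "h \<in> L" using k assms(3) by (simp add: m_assoc[symmetric])
qed (use subgroup.m_closed[OF assms(1,2)] in blast)

text \<open>A nonzero invariant subspace of least dimension is irreducible.\<close>
lemma minimal_invariant_subspace:
  fixes T :: "'i \<Rightarrow> ('c \<Rightarrow> complex) \<Rightarrow> 'c \<Rightarrow> complex"
  assumes "finite S" and W: "fun_space.subspace W" "W \<subseteq> fun_space.span S" "W \<noteq> {0}"
    and inv: "\<And>g f. g \<in> A \<Longrightarrow> f \<in> W \<Longrightarrow> T g f \<in> W"
  obtains U where "fun_space.subspace U" "U \<subseteq> W" "U \<noteq> {0}"
    "\<And>g f. g \<in> A \<Longrightarrow> f \<in> U \<Longrightarrow> T g f \<in> U"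
    "\<And>U'. fun_space.subspace U' \<Longrightarrow> U' \<subseteq> U \<Longrightarrow> (\<And>g f. g \<in> A \<Longrightarrow> f \<in> U' \<Longrightarrow> T g f \<in> U')
       \<Longrightarrow> U' = {0} \<or> U' = U"
proof -
  define P where "P U \<longleftrightarrow> fun_space.subspace U \<and> U \<subseteq> W \<and> U \<noteq> {0} \<and> (\<forall>g\<in>A. \<forall>f\<in>U. T g f \<in> U)" for U
  have "P W" using assms by (simp add: P_def)
  then obtain U where U: "P U" "\<And>U'. P U' \<Longrightarrow> fun_space.dim U \<le> fun_space.dim U'"
    using ex_has_least_nat[of P W fun_space.dim] by metis
  have US: "U \<subseteq> fun_space.span S" using U(1) W(2) by (auto simp: P_def)
  have "U' = {0} \<or> U' = U"
    if U': "fun_space.subspace U'" "U' \<subseteq> U" "\<And>g f. g \<in> A \<Longrightarrow> f \<in> U' \<Longrightarrow> T g f \<in> U'" for U'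
  proof (rule ccontr)
    assume neg: "\<not> (U' = {0} \<or> U' = U)"
    hence "P U'" using U' U(1) by (auto simp: P_def)
    hence dim: "fun_space.dim U \<le> fun_space.dim U'" by (rule U(2))
    obtain u where u: "u \<in> U" "u \<notin> U'" using neg U'(2) by auto
    obtain C where C: "C \<subseteq> U" "fun_space.independent C" "U \<subseteq> fun_space.span C" "card C = fun_space.dim U"
      using fun_space.basis_exists[of U] by metis
    obtain C' where C': "C' \<subseteq> U'" "fun_space.independent C'" "U' \<subseteq> fun_space.span C'" "card C' = fun_space.dim U'"
      using fun_space.basis_exists[of U'] by metis
    have finC: "finite C"
      using fun_space.independent_span_bound[OF assms(1) C(2) order.trans[OF C(1) US]] by simp
    have finC': "finite C'"
      using fun_space.independent_span_bound[OF assms(1) C'(2)] order.trans[OF C'(1) order.trans[OF U'(2) US]] by simp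
    have "fun_space.span C' \<subseteq> U'" using fun_space.span_minimal[OF C'(1) U'(1)] .
    hence notin: "u \<notin> fun_space.span C'" using u(2) by blast
    hence ind: "fun_space.independent (insert u C')"
      using C'(2) fun_space.independent_insert by metis
    have "insert u C' \<subseteq> fun_space.span C" using C'(1) U'(2) C(3) u(1) by blast
    hence "card (insert u C') \<le> card C"
      using fun_space.independent_span_bound[OF finC ind] by simp
    moreover have "u \<notin> C'" using notin fun_space.span_base by metis
    ultimately show False using dim C(4) C'(4) finC' by simp
  qed
  with U(1) show ?thesis using that[of U] by (simp add: P_def)
qed

section \<open>A criterion for vanishing\<close>

text \<open>The irreducible character is afforded by a minimal invariant subspace \<open>U\<close> of the space \<open>W\<close> of
  functions that are constant on the cosets of \<open>K\<close> and annihilated by the sum of the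
  translations by elements of \<open>B\<close>.\<close>
theorem vanishing_if_coset_conjugate:
  fixes G (structure)
  assumes "group G" and fin: "finite (carrier G)" and K: "K \<lhd> G" and B: "B \<lhd> G" and KB: "K \<subset> B"
    and x: "x \<in> carrier G"
    and conj: "\<And>b. b \<in> B \<Longrightarrow> \<exists>g\<in>carrier G. \<exists>k\<in>K. g \<otimes> x \<otimes> inv g = k \<otimes> b \<otimes> x"
  shows "\<not> non_vanishing G x"
proof -
  interpret group G by fact
  interpret K: normal K G by fact
  interpret B: normal B G by fact
  have finB: "finite B" using fin B.subset finite_subset by blast
  define T where "T g f = (\<lambda>h. if h \<in> carrier G then f (inv g \<otimes> h) else 0)" for g and f :: "'a \<Rightarrow> complex"
  define W where "W = {f :: 'a \<Rightarrow> complex. (\<forall>h. h \<notin> carrier G \<longrightarrow> f h = 0) \<and>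
    (\<forall>k\<in>K. \<forall>h\<in>carrier G. f (k \<otimes> h) = f h) \<and> (\<forall>h\<in>carrier G. (\<Sum>b\<in>B. f (inv b \<otimes> h)) = 0)}"
  define S where "S = (\<lambda>g h. if h = g then 1 else 0 :: complex) ` carrier G"
  have finS: "finite S" using fin by (simp add: S_def)
  have sub: "fun_space.subspace W"
    unfolding fun_space.subspace_def W_def by (auto simp: sum.distrib sum_distrib_left[symmetric])
  have span: "W \<subseteq> fun_space.span S"
  proof
    fix f assume f: "f \<in> W"
    have "f = (\<Sum>g\<in>carrier G. (\<lambda>x. f g * (if x = g then 1 else 0)))"
    proof
      fix y
      have "(\<Sum>g\<in>carrier G. f g * (if y = g then 1 else 0)) = (if y \<in> carrier G then f y else 0)"
        using fin by (simp add: if_distrib cong: if_cong)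
      thus "f y = (\<Sum>g\<in>carrier G. (\<lambda>x. f g * (if x = g then 1 else 0))) y"
        using f by (simp add: sum_fun_app W_def)
    qed
    moreover have "(\<Sum>g\<in>carrier G. (\<lambda>x. f g * (if x = g then 1 else 0))) \<in> fun_space.span S"
      by (intro fun_space.span_sum fun_space.span_scale fun_space.span_base) (auto simp: S_def)
    ultimately show "f \<in> fun_space.span S" by simp
  qed
  obtain b0 where b0: "b0 \<in> B" "b0 \<notin> K" using KB by auto
  have BG: "b \<in> carrier G" if "b \<in> B" for b using that B.subset by blast
  have KG: "k \<in> carrier G" if "k \<in> K" for k using that K.subset by blast
  \<comment> \<open>a nonzero element of \<open>W\<close>: the difference of the indicators of \<open>K\<close> and of its coset by \<open>b0\<close>\<close>
  define f0 where "f0 h = (if h \<in> K then 1 else 0) - (if h \<in> carrier G \<and> inv b0 \<otimes> h \<in> K then 1 else 0 :: complex)" for h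
  have "f0 \<in> W"
  proof -
    have "f0 (k \<otimes> h) = f0 h" if k: "k \<in> K" and h: "h \<in> carrier G" for k h
    proof -
      have "k \<otimes> h \<in> K \<longleftrightarrow> h \<in> K"
        using subgroup_mult_mem_iff[OF K.subgroup_axioms k h] .
      moreover have "inv b0 \<otimes> (k \<otimes> h) \<in> K \<longleftrightarrow> inv b0 \<otimes> h \<in> K"
      proof -
        have k': "inv b0 \<otimes> k \<otimes> b0 \<in> K" using K.inv_op_closed1 BG[OF b0(1)] k by simp
        have "inv b0 \<otimes> (k \<otimes> h) = (inv b0 \<otimes> k \<otimes> b0) \<otimes> (inv b0 \<otimes> h)"
          using BG[OF b0(1)] KG[OF k] h by (simp add: m_assoc[symmetric]) (simp add: m_assoc)
        thus ?thesis using subgroup_mult_mem_iff[OF K.subgroup_axioms k', of "inv b0 \<otimes> h"] BG[OF b0(1)] h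
          by simp
      qed
      ultimately show ?thesis using KG[OF k] h by (simp add: f0_def)
    qed
    moreover have "(\<Sum>b\<in>B. f0 (inv b \<otimes> h)) = 0" if h: "h \<in> carrier G" for h
    proof -
      have bij: "bij_betw (\<lambda>b. b \<otimes> b0) B B"
        by (rule bij_betw_byWitness[where f' = "\<lambda>b. b \<otimes> inv b0"])
          (use b0 BG in \<open>auto simp: m_assoc\<close>)
      have "(\<Sum>b\<in>B. if inv b \<otimes> h \<in> K then 1 else 0 :: complex)
          = (\<Sum>b\<in>B. if inv (b \<otimes> b0) \<otimes> h \<in> K then 1 else 0)"
        by (rule sum.reindex_bij_betw[OF bij, symmetric])
      also have "\<dots> = (\<Sum>b\<in>B. if inv b0 \<otimes> (inv b \<otimes> h) \<in> K then 1 else 0)"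
        using b0 BG h by (intro sum.cong refl) (simp add: inv_mult_group m_assoc)
      finally show ?thesis using h BG by (simp add: f0_def sum_subtractf)
    qed
    ultimately show ?thesis by (auto simp: W_def f0_def KG)
  qed
  moreover have "f0 \<one> \<noteq> 0"
  proof -
    have "inv b0 \<notin> K" using b0 BG K.m_inv_closed[of "inv b0"] by auto
    thus ?thesis using BG[OF b0(1)] by (simp add: f0_def)
  qed
  ultimately have nz: "W \<noteq> {0}" by auto
  have T_closed: "T g f \<in> W" if g: "g \<in> carrier G" and f: "f \<in> W" for g f
  proof -
    have "f (inv g \<otimes> (k \<otimes> h)) = f (inv g \<otimes> h)" if k: "k \<in> K" and h: "h \<in> carrier G" for k h
    proof -
      have k': "inv g \<otimes> k \<otimes> g \<in> K" using K.inv_op_closed1 g k by simp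
      have "inv g \<otimes> (k \<otimes> h) = (inv g \<otimes> k \<otimes> g) \<otimes> (inv g \<otimes> h)"
        using g KG[OF k] h by (simp add: m_assoc[symmetric]) (simp add: m_assoc)
      thus ?thesis using f k' g h by (simp add: W_def)
    qed
    moreover have "(\<Sum>b\<in>B. f (inv g \<otimes> (inv b \<otimes> h))) = 0" if h: "h \<in> carrier G" for h
    proof -
      have bij: "bij_betw (\<lambda>b. g \<otimes> b \<otimes> inv g) B B"
      proof (rule bij_betw_byWitness[where f' = "\<lambda>b. inv g \<otimes> b \<otimes> g"])
        show "\<forall>b\<in>B. inv g \<otimes> (g \<otimes> b \<otimes> inv g) \<otimes> g = b" "\<forall>b\<in>B. g \<otimes> (inv g \<otimes> b \<otimes> g) \<otimes> inv g = b"
          using g BG by (auto simp: m_assoc[symmetric]) (auto simp: m_assoc)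
      qed (use g B.inv_op_closed1 B.inv_op_closed2 in auto)
      have "(\<Sum>b\<in>B. f (inv g \<otimes> (inv b \<otimes> h))) = (\<Sum>b\<in>B. f (inv g \<otimes> (inv (g \<otimes> b \<otimes> inv g) \<otimes> h)))"
        by (rule sum.reindex_bij_betw[OF bij, symmetric])
      also have "\<dots> = (\<Sum>b\<in>B. f (inv b \<otimes> (inv g \<otimes> h)))"
      proof (intro sum.cong refl)
        fix b assume b: "b \<in> B"
        show "f (inv g \<otimes> (inv (g \<otimes> b \<otimes> inv g) \<otimes> h)) = f (inv b \<otimes> (inv g \<otimes> h))"
          using g BG[OF b] h by (simp add: word_simps)
      qed
      also have "\<dots> = 0" using f g h by (simp add: W_def)
      finally show ?thesis .
    qed
    ultimately show ?thesis using g KG BG by (auto simp: W_def T_def)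
  qed
  obtain U where U: "fun_space.subspace U" "U \<subseteq> W" "U \<noteq> {0}"
    "\<And>g f. g \<in> carrier G \<Longrightarrow> f \<in> U \<Longrightarrow> T g f \<in> U"
    "\<And>U'. fun_space.subspace U' \<Longrightarrow> U' \<subseteq> U \<Longrightarrow> (\<And>g f. g \<in> carrier G \<Longrightarrow> f \<in> U' \<Longrightarrow> T g f \<in> U')
       \<Longrightarrow> U' = {0} \<or> U' = U"
  proof (rule minimal_invariant_subspace[where A = "carrier G" and T = T, OF finS sub span nz], goal_cases)
    case (1 g f)
    show ?case by (rule T_closed[OF 1(2,3)])
  next
    case (2 U)
    show ?case by (rule 2(1)[OF 2(2-6)])
  qed
  have T_add: "T g (f + f') = T g f + T g f'" for g f f' by (auto simp: T_def)
  have T_scale: "T g (\<lambda>x. c * f x) = (\<lambda>x. c * T g f x)" for g c f by (auto simp: T_def)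
  have T_mult: "T (g \<otimes> h) f = T g (T h f)" if "g \<in> carrier G" "h \<in> carrier G" for g h f
    using that by (auto simp: T_def inv_mult_group m_assoc)
  have T_one: "T \<one> f = f" if "f \<in> U" for f
  proof -
    have "f \<in> W" using that U(2) by blast
    thus ?thesis by (auto simp: T_def W_def)
  qed
  obtain n \<rho> where irr: "irreducible_representation G n \<rho>"
    and rho_eq: "\<And>g h. (\<And>f. f \<in> U \<Longrightarrow> T g f = T h f) \<Longrightarrow> \<rho> g = \<rho> h"
    and rho_sum: "\<And>A i j. A \<subseteq> carrier G \<Longrightarrow> (\<And>f. f \<in> U \<Longrightarrow> (\<Sum>a\<in>A. T a f) = 0) \<Longrightarrow> i < n \<Longrightarrow> j < n
           \<Longrightarrow> (\<Sum>a\<in>A. \<rho> a $$ (i, j)) = 0"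
  proof (rule irreducible_matrix_representation[where T = T, OF assms(1) finS U(1) order.trans[OF U(2) span] U(3)],
      goal_cases)
    case (1 g f)
    show ?case by (rule U(4)[OF 1(2,3)])
  next
    case (4 g h f)
    show ?case by (rule T_mult[OF 4(2,3)])
  next
    case (5 f)
    show ?case by (rule T_one[OF 5(2)])
  next
    case (6 U')
    show ?case by (rule U(5)[OF 6(2-4)])
  next
    case (7 n \<rho>)
    show ?case by (rule 7(1)[OF 7(2-4)])
  qed (rule T_add T_scale)+
  have rep: "matrix_representation G n \<rho>" using irr by (simp add: irreducible_representation_def)
  note car = matrix_representationD(1)[OF rep] and mult = matrix_representationD(2)[OF rep]
  have rho_K: "\<rho> (k \<otimes> g) = \<rho> g" if k: "k \<in> K" and g: "g \<in> carrier G" for k g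
  proof (rule rho_eq)
    fix f assume "f \<in> U"
    hence f: "f \<in> W" using U(2) by blast
    have "f (inv (k \<otimes> g) \<otimes> h) = f (inv g \<otimes> h)" if h: "h \<in> carrier G" for h
    proof -
      have k': "inv g \<otimes> inv k \<otimes> g \<in> K" using K.inv_op_closed1 g k by simp
      have "inv (k \<otimes> g) \<otimes> h = (inv g \<otimes> inv k \<otimes> g) \<otimes> (inv g \<otimes> h)"
        using g KG[OF k] h by (simp add: inv_mult_group m_assoc[symmetric]) (simp add: m_assoc)
      thus ?thesis using f k' g h by (simp add: W_def)
    qed
    thus "T (k \<otimes> g) f = T g f" by (auto simp: T_def)
  qed
  have rho_B: "(\<Sum>b\<in>B. \<rho> b $$ (i, j)) = 0" if "i < n" "j < n" for i j
  proof (rule rho_sum[OF B.subset _ that])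
    fix f assume "f \<in> U"
    hence f: "f \<in> W" using U(2) by blast
    show "(\<Sum>a\<in>B. T a f) = 0"
    proof
      fix h show "(\<Sum>a\<in>B. T a f) h = 0 h"
        using f by (cases "h \<in> carrier G") (simp_all add: sum_fun_app T_def W_def)
    qed
  qed
  have tr: "mat_trace (\<rho> (b \<otimes> x)) = mat_trace (\<rho> x)" if b: "b \<in> B" for b
  proof -
    obtain g k where gk: "g \<in> carrier G" "k \<in> K" "g \<otimes> x \<otimes> inv g = k \<otimes> b \<otimes> x" using conj[OF b] by blast
    have "mat_trace (\<rho> (b \<otimes> x)) = mat_trace (\<rho> (k \<otimes> (b \<otimes> x)))"
      using rho_K gk(2) BG[OF b] x by simp
    also have "\<dots> = mat_trace (\<rho> ((g \<otimes> x) \<otimes> inv g))"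
      using gk BG[OF b] KG x by (simp add: m_assoc)
    also have "\<dots> = mat_trace (\<rho> (g \<otimes> x) * \<rho> (inv g))"
      using mult[of "g \<otimes> x" "inv g"] gk x by simp
    also have "\<dots> = mat_trace (\<rho> (inv g) * \<rho> (g \<otimes> x))"
      using gk x by (intro mat_trace_commute[of _ n] car) auto
    also have "\<dots> = mat_trace (\<rho> (inv g \<otimes> (g \<otimes> x)))"
      using mult[of "inv g" "g \<otimes> x"] gk x by simp
    also have "inv g \<otimes> (g \<otimes> x) = x" using gk(1) x by (simp add: m_assoc[symmetric])
    finally show ?thesis .
  qed
  \<comment> \<open>the average over \<open>B\<close> is the trace of \<open>(\<Sum>b\<in>B. \<rho> b) * \<rho> x = 0\<close>\<close>
  have "of_nat (card B) * mat_trace (\<rho> x) = (\<Sum>b\<in>B. mat_trace (\<rho> (b \<otimes> x)))"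
    using tr by simp
  also have "\<dots> = (\<Sum>b\<in>B. \<Sum>i<n. \<Sum>j<n. \<rho> b $$ (i,j) * \<rho> x $$ (j,i))"
    by (intro sum.cong refl) (simp add: mult BG x mat_trace_mult[OF car car])
  also have "\<dots> = (\<Sum>i<n. \<Sum>j<n. (\<Sum>b\<in>B. \<rho> b $$ (i,j)) * \<rho> x $$ (j,i))"
    by (subst sum.swap, rule sum.cong[OF refl], subst sum.swap) (simp add: sum_distrib_right)
  also have "\<dots> = 0" using rho_B by simp
  finally have "mat_trace (\<rho> x) = 0" using finB b0 by auto
  moreover have "(\<lambda>g\<in>carrier G. mat_trace (\<rho> g)) \<in> Irr G"
    unfolding Irr_def using irr by blast
  ultimately show ?thesis using x by (auto simp: non_vanishing_def intro!: bexI[of _ "\<lambda>g\<in>carrier G. mat_trace (\<rho> g)"])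
qed

section \<open>Maximal subgroups and passage to quotients\<close>

lemma subgroup_restrict_iff:
  assumes "group G" "subgroup M G"
  shows "subgroup K (G\<lparr>carrier := M\<rparr>) \<longleftrightarrow> subgroup K G \<and> K \<subseteq> M"
  using group.incl_subgroup[OF assms] group.subgroup_incl[OF assms(1) _ assms(2), of K]
    subgroup.subset[of K "G\<lparr>carrier := M\<rparr>"] by auto

text \<open>\<open>H\<close> is a maximal subgroup of \<open>M\<close>, where both are given as subgroups of the ambient group \<open>G\<close>.\<close>
definition maximal_in :: "('a, 'b) monoid_scheme \<Rightarrow> 'a set \<Rightarrow> 'a set \<Rightarrow> bool" where
  "maximal_in G H M \<longleftrightarrow> subgroup H G \<and> subgroup M G \<and> H \<subset> M \<and>
     (\<forall>K. subgroup K G \<longrightarrow> H \<subseteq> K \<longrightarrow> K \<subseteq> M \<longrightarrow> K = H \<or> K = M)"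

lemma maximal_subgroup_restrict_iff:
  assumes "group G" "subgroup M G"
  shows "maximal_subgroup H (G\<lparr>carrier := M\<rparr>) \<longleftrightarrow> maximal_in G H M"
  unfolding maximal_subgroup_def proper_subgroup_def maximal_in_def subgroup_restrict_iff[OF assms]
  using assms(2) by auto

lemma maximal_subgroup_iff:
  assumes "group G"
  shows "maximal_subgroup H G \<longleftrightarrow> maximal_in G H (carrier G)"
  using maximal_subgroup_restrict_iff[OF assms group.subgroup_self[OF assms]] by simp

lemma WSM_group_iff:
  assumes "group G"
  shows "WSM_group G \<longleftrightarrow> (\<forall>H M L. maximal_in G H M \<longrightarrow> maximal_in G M (carrier G) \<longrightarrow>
     maximal_in G L (carrier G) \<longrightarrow> H \<subseteq> L \<longrightarrow> maximal_in G H L)"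
proof -
  have sub: "subgroup M G" if "maximal_in G M (carrier G)" for M
    using that by (simp add: maximal_in_def)
  have 1: "weak_second_maximal H G \<longleftrightarrow> (\<exists>M. maximal_in G H M \<and> maximal_in G M (carrier G))" for H
    unfolding weak_second_maximal_def Max_over_def maximal_subgroup_iff[OF assms]
    using maximal_subgroup_restrict_iff[OF assms sub]
    by (auto simp: maximal_in_def proper_subgroup_def dest: subgroup.subset)
  have 2: "second_maximal H G \<longleftrightarrow> proper_subgroup H G \<and>
      (\<forall>L. maximal_in G L (carrier G) \<longrightarrow> H \<subseteq> L \<longrightarrow> maximal_in G H L)" for H
    unfolding second_maximal_def Max_over_def maximal_subgroup_iff[OF assms]
    using maximal_subgroup_restrict_iff[OF assms sub] by auto
  have 3: "proper_subgroup H G" if "maximal_in G H M" for H M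
    using that by (auto simp: proper_subgroup_def maximal_in_def dest: subgroup.subset)
  show ?thesis unfolding WSM_group_def 1 2
  proof (intro iffI conjI allI impI assms)
    fix H assume *: "\<forall>H M L. maximal_in G H M \<longrightarrow> maximal_in G M (carrier G) \<longrightarrow>
      maximal_in G L (carrier G) \<longrightarrow> H \<subseteq> L \<longrightarrow> maximal_in G H L"
      and "\<exists>M. maximal_in G H M \<and> maximal_in G M (carrier G)"
    then obtain M where M: "maximal_in G H M" "maximal_in G M (carrier G)" by (elim exE conjE)
    show "proper_subgroup H G" by (rule 3[OF M(1)])
    fix L assume "maximal_in G L (carrier G)" "H \<subseteq> L"
    with * M show "maximal_in G H L" by blast
  next
    fix H M L assume *: "group G \<and> (\<forall>H. (\<exists>M. maximal_in G H M \<and> maximal_in G M (carrier G)) \<longrightarrow>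
        proper_subgroup H G \<and> (\<forall>L. maximal_in G L (carrier G) \<longrightarrow> H \<subseteq> L \<longrightarrow> maximal_in G H L))"
      and M: "maximal_in G H M" "maximal_in G M (carrier G)" and L: "maximal_in G L (carrier G)" "H \<subseteq> L"
    have "\<exists>M. maximal_in G H M \<and> maximal_in G M (carrier G)" using M by (intro exI conjI)
    with * L show "maximal_in G H L" by blast
  qed
qed

text \<open>The correspondence theorem: for a surjective homomorphism, taking preimages identifies the
  subgroups of the image with the subgroups containing the kernel.\<close>
lemma (in group_hom) maximal_in_preimage_iff:
  assumes surj: "h ` carrier G = carrier H" and S: "subgroup S H" and M: "subgroup M H"
  shows "maximal_in H S M \<longleftrightarrow> maximal_in G {g \<in> carrier G. h g \<in> S} {g \<in> carrier G. h g \<in> M}"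
proof -
  define p where "p A = {g \<in> carrier G. h g \<in> A}" for A
  have p_sub: "subgroup (p A) G" if "subgroup A H" for A
  proof -
    interpret A: subgroup A H by fact
    have "\<one> \<in> p A" by (simp add: p_def)
    thus ?thesis by (intro G.subgroupI) (auto simp: p_def)
  qed
  have h_p: "h ` p A = A" if "A \<subseteq> carrier H" for A
    using that surj by (auto simp: p_def)
  have p_mono: "p A \<subseteq> p B \<longleftrightarrow> A \<subseteq> B" if "A \<subseteq> carrier H" "B \<subseteq> carrier H" for A B
  proof
    assume "p A \<subseteq> p B"
    hence "h ` p A \<subseteq> h ` p B" by (rule image_mono)
    thus "A \<subseteq> B" using h_p that by simp
  qed (auto simp: p_def)
  have p_eq: "p A = p B \<longleftrightarrow> A = B" if "A \<subseteq> carrier H" "B \<subseteq> carrier H" for A B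
    using h_p[OF that(1)] h_p[OF that(2)] by metis
  have p_h: "p (h ` K) = K" if K: "subgroup K G" "p A \<subseteq> K" "subgroup A H" for A K
  proof (intro equalityI subsetI)
    fix g assume "g \<in> p (h ` K)"
    then obtain k where k: "g \<in> carrier G" "k \<in> K" "h g = h k" by (auto simp: p_def)
    have kG: "k \<in> carrier G" using k(2) subgroup.subset[OF K(1)] by blast
    have "h (g \<otimes> inv k) = \<one>\<^bsub>H\<^esub>" using k kG by simp
    hence "g \<otimes> inv k \<in> p A" using k kG subgroup.one_closed[OF K(3)] by (simp add: p_def)
    hence "g \<otimes> inv k \<otimes> k \<in> K" using K(2) k(2) subgroup.m_closed[OF K(1)] by blast
    thus "g \<in> K" using k kG by (simp add: G.m_assoc)
  next
    fix g assume "g \<in> K" thus "g \<in> p (h ` K)" using subgroup.subset[OF K(1)] by (auto simp: p_def)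
  qed
  have SM: "S \<subseteq> carrier H" "M \<subseteq> carrier H" using S M by (auto dest: subgroup.subset)
  have "(\<forall>K. subgroup K H \<longrightarrow> S \<subseteq> K \<longrightarrow> K \<subseteq> M \<longrightarrow> K = S \<or> K = M) \<longleftrightarrow>
        (\<forall>K. subgroup K G \<longrightarrow> p S \<subseteq> K \<longrightarrow> K \<subseteq> p M \<longrightarrow> K = p S \<or> K = p M)" (is "?L \<longleftrightarrow> ?R")
  proof
    assume L: ?L
    show ?R
    proof (intro allI impI)
      fix K assume K: "subgroup K G" "p S \<subseteq> K" "K \<subseteq> p M"
      have "S \<subseteq> h ` K" using K(2) h_p[OF SM(1)] by blast
      moreover have "h ` K \<subseteq> M" using K(3) h_p[OF SM(2)] by blast
      ultimately have "h ` K = S \<or> h ` K = M" using L subgroup_img_is_subgroup[OF K(1)] by blast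
      thus "K = p S \<or> K = p M" using p_h[OF K(1,2) S] by metis
    qed
  next
    assume R: ?R
    show ?L
    proof (intro allI impI)
      fix K assume K: "subgroup K H" "S \<subseteq> K" "K \<subseteq> M"
      hence "p K = p S \<or> p K = p M" using R p_sub p_mono SM subgroup.subset[OF K(1)] by blast
      thus "K = S \<or> K = M" using p_eq SM subgroup.subset[OF K(1)] by blast
    qed
  qed
  moreover have "S \<subset> M \<longleftrightarrow> p S \<subset> p M" using p_mono[OF SM] p_eq[OF SM] by (metis psubset_eq)
  ultimately show ?thesis using S M p_sub by (simp add: maximal_in_def p_def[symmetric])
qed

lemma (in group_hom) WSM_group_image:
  assumes surj: "h ` carrier G = carrier H" and "WSM_group G"
  shows "WSM_group H"
  unfolding WSM_group_iff[OF H.is_group]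
proof (intro allI impI)
  fix S M L
  assume *: "maximal_in H S M" "maximal_in H M (carrier H)" "maximal_in H L (carrier H)" "S \<subseteq> L"
  have sub: "subgroup S H" "subgroup M H" "subgroup L H" using * by (auto simp: maximal_in_def)
  have c: "{g \<in> carrier G. h g \<in> carrier H} = carrier G" by auto
  note pre = maximal_in_preimage_iff[OF surj]
  have "maximal_in G {g \<in> carrier G. h g \<in> S} {g \<in> carrier G. h g \<in> M}"
       "maximal_in G {g \<in> carrier G. h g \<in> M} (carrier G)"
       "maximal_in G {g \<in> carrier G. h g \<in> L} (carrier G)"
    using * pre[OF sub(1,2)] pre[OF sub(2) H.subgroup_self] pre[OF sub(3) H.subgroup_self] c by simp_all
  hence "maximal_in G {g \<in> carrier G. h g \<in> S} {g \<in> carrier G. h g \<in> L}"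
    using assms(2)[unfolded WSM_group_iff[OF G.is_group]] *(4) by blast
  thus "maximal_in H S L" using pre[OF sub(1,3)] by simp
qed

lemma (in group_hom) non_vanishing_image:
  assumes surj: "h ` carrier G = carrier H" and x: "non_vanishing G x"
  shows "non_vanishing H (h x)"
proof -
  have xG: "x \<in> carrier G" using x by (simp add: non_vanishing_def)
  have "mat_trace (\<rho> (h x)) \<noteq> 0" if "irreducible_representation H n \<rho>" for n \<rho>
  proof -
    have 1: "matrix_representation G n (\<lambda>g. \<rho> (h g))"
      using that by (auto simp: irreducible_representation_def matrix_representation_def hom_def)
    have 2: "invariant_subspace H n \<rho> W" if "invariant_subspace G n (\<lambda>g. \<rho> (h g)) W" for W
      using that unfolding invariant_subspace_def surj[symmetric] by simp
    have 3: "n > 0" and 4: "\<And>W. invariant_subspace H n \<rho> W \<Longrightarrow> W = {0\<^sub>v n} \<or> W = carrier_vec n"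
      using that unfolding irreducible_representation_def by blast+
    have "irreducible_representation G n (\<lambda>g. \<rho> (h g))"
      unfolding irreducible_representation_def by (intro conjI allI impI 1 3 4 2)
    hence "(\<lambda>g\<in>carrier G. mat_trace (\<rho> (h g))) \<in> Irr G"
      unfolding Irr_def by (intro CollectI exI[of _ n] exI[of _ "\<lambda>g. \<rho> (h g)"] conjI refl)
    hence "(\<lambda>g\<in>carrier G. mat_trace (\<rho> (h g))) x \<noteq> 0" using x unfolding non_vanishing_def by blast
    thus ?thesis using xG by simp
  qed
  thus ?thesis using xG by (auto simp: non_vanishing_def Irr_def)
qed

section \<open>The lower central series\<close>

text \<open>The series \<open>Y\<close>, \<open>[Y, Y]\<close>, \<open>[[Y, Y], Y]\<close> and so on, formed inside \<open>G\<close>; the term with index \<open>0\<close> is \<open>Y\<close>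
  itself.\<close>
definition lower_central :: "('a, 'b) monoid_scheme \<Rightarrow> 'a set \<Rightarrow> nat \<Rightarrow> 'a set" where
  "lower_central G Y n = ((\<lambda>A. commutator_subgroup G A Y) ^^ n) Y"

lemma lower_central_0 [simp]: "lower_central G Y 0 = Y"
  by (simp add: lower_central_def)

lemma lower_central_Suc: "lower_central G Y (Suc n) = commutator_subgroup G (lower_central G Y n) Y"
  by (simp add: lower_central_def)

context group
begin

lemma commutator_in_commutator_subgroup:
  assumes "h \<in> A" "k \<in> B"
  shows "h \<otimes> k \<otimes> inv h \<otimes> inv k \<in> commutator_subgroup G A B"
  unfolding commutator_subgroup_def using assms by (intro generate.incl) auto

lemma commutator_subgroup_minimal:
  assumes "subgroup L G" and "\<And>h k. h \<in> A \<Longrightarrow> k \<in> B \<Longrightarrow> h \<otimes> k \<otimes> inv h \<otimes> inv k \<in> L"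
  shows "commutator_subgroup G A B \<subseteq> L"
  unfolding commutator_subgroup_def using assms by (intro generate_subgroup_incl) auto

lemma commutator_subgroup_normal:
  assumes A: "A \<lhd> G" and B: "B \<lhd> G"
  shows "commutator_subgroup G A B \<lhd> G"
  unfolding commutator_subgroup_def
proof (rule normal_generateI)
  interpret A: normal A G by fact
  interpret B: normal B G by fact
  show "(\<Union>h\<in>A. \<Union>k\<in>B. {h \<otimes> k \<otimes> inv h \<otimes> inv k}) \<subseteq> carrier G" by auto
  fix c g assume "c \<in> (\<Union>h\<in>A. \<Union>k\<in>B. {h \<otimes> k \<otimes> inv h \<otimes> inv k})" and g: "g \<in> carrier G"
  then obtain h k where hk: "h \<in> A" "k \<in> B" "c = h \<otimes> k \<otimes> inv h \<otimes> inv k" by auto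
  have "g \<otimes> c \<otimes> inv g = (g \<otimes> h \<otimes> inv g) \<otimes> (g \<otimes> k \<otimes> inv g) \<otimes> inv (g \<otimes> h \<otimes> inv g) \<otimes> inv (g \<otimes> k \<otimes> inv g)"
    using g A.mem_carrier[OF hk(1)] B.mem_carrier[OF hk(2)]
    by (simp add: hk(3) word_simps)
  thus "g \<otimes> c \<otimes> inv g \<in> (\<Union>h\<in>A. \<Union>k\<in>B. {h \<otimes> k \<otimes> inv h \<otimes> inv k})"
    using A.inv_op_closed2[OF g hk(1)] B.inv_op_closed2[OF g hk(2)] by auto
qed

lemma commutator_subgroup_subset:
  assumes "A \<lhd> G" "B \<subseteq> carrier G"
  shows "commutator_subgroup G A B \<subseteq> A"
proof (rule commutator_subgroup_minimal)
  interpret A: normal A G by fact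
  show "subgroup A G" by (rule A.subgroup_axioms)
  fix h k assume "h \<in> A" "k \<in> B"
  hence "h \<otimes> (k \<otimes> inv h \<otimes> inv k) \<in> A" using assms(2) by (intro A.m_closed A.inv_op_closed2) auto
  thus "h \<otimes> k \<otimes> inv h \<otimes> inv k \<in> A" using \<open>h \<in> A\<close> \<open>k \<in> B\<close> assms(2) A.mem_carrier
    by (simp add: m_assoc subset_iff)
qed

lemma lower_central_normal: "Y \<lhd> G \<Longrightarrow> lower_central G Y n \<lhd> G"
  by (induction n) (auto simp: lower_central_Suc commutator_subgroup_normal)

lemma lower_central_Suc_subset: "Y \<lhd> G \<Longrightarrow> lower_central G Y (Suc n) \<subseteq> lower_central G Y n"
  by (simp add: lower_central_Suc lower_central_normal commutator_subgroup_subset normal_imp_subgroup subgroup.subset)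

lemma lower_central_antimono: "Y \<lhd> G \<Longrightarrow> m \<le> n \<Longrightarrow> lower_central G Y n \<subseteq> lower_central G Y m"
  using lift_Suc_antimono_le[of "lower_central G Y"] lower_central_Suc_subset by blast

lemma lower_central_restrict:
  assumes "Y \<lhd> G"
  shows "lower_central (G\<lparr>carrier := Y\<rparr>) Y n = lower_central G Y n"
proof (induction n)
  case (Suc n)
  have Y: "subgroup Y G" using assms by (rule normal_imp_subgroup)
  have sub: "lower_central G Y n \<subseteq> Y" using lower_central_antimono[OF assms, of 0 n] by simp
  have "(\<Union>h\<in>lower_central G Y n. \<Union>k\<in>Y. {h \<otimes> k \<otimes> inv\<^bsub>G\<lparr>carrier := Y\<rparr>\<^esub> h \<otimes> inv\<^bsub>G\<lparr>carrier := Y\<rparr>\<^esub> k})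
      = (\<Union>h\<in>lower_central G Y n. \<Union>k\<in>Y. {h \<otimes> k \<otimes> inv h \<otimes> inv k})"
    using sub by (intro SUP_cong refl) (auto simp: m_inv_consistent[OF Y] subset_iff)
  moreover have "\<dots> \<subseteq> Y"
  proof -
    interpret Y: subgroup Y G by fact
    show ?thesis using sub by (auto simp: subset_iff)
  qed
  ultimately show ?case
    using generate_consistent[OF _ Y] by (simp add: lower_central_Suc Suc commutator_subgroup_def)
qed simp

lemma nilpotent_restrict_iff:
  assumes "Y \<lhd> G"
  shows "nilpotent (G\<lparr>carrier := Y\<rparr>) \<longleftrightarrow> (\<exists>n. lower_central G Y n = {\<one>})"
  using lower_central_restrict[OF assms] by (simp add: nilpotent_def lower_central_def)

end

lemma (in group_hom) lower_central_image:
  assumes "Y \<lhd> G"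
  shows "h ` lower_central G Y n = lower_central H (h ` Y) n"
proof (induction n)
  case (Suc n)
  have sub: "lower_central G Y n \<subseteq> carrier G" "Y \<subseteq> carrier G"
    using G.lower_central_normal[OF assms] assms normal_imp_subgroup subgroup.subset by blast+
  hence img: "h ` (\<Union>a\<in>lower_central G Y n. \<Union>k\<in>Y. {a \<otimes> k \<otimes> inv a \<otimes> inv k})
     = (\<Union>a\<in>lower_central H (h ` Y) n. \<Union>k\<in>h ` Y. {a \<otimes>\<^bsub>H\<^esub> k \<otimes>\<^bsub>H\<^esub> inv\<^bsub>H\<^esub> a \<otimes>\<^bsub>H\<^esub> inv\<^bsub>H\<^esub> k})"
    unfolding Suc[symmetric] by (force simp: image_UN subset_iff)
  have sub': "(\<Union>a\<in>lower_central G Y n. \<Union>k\<in>Y. {a \<otimes> k \<otimes> inv a \<otimes> inv k}) \<subseteq> carrier G"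
    using sub by (auto simp: subset_iff)
  show ?case
    unfolding lower_central_Suc commutator_subgroup_def by (rule generate_img[OF sub', unfolded img, symmetric])
qed simp

section \<open>Sylow subgroups and complements\<close>

text \<open>The conjugate \<open>g S g\<^sup>-\<^sup>1\<close> of a set \<open>S\<close>.\<close>
definition conjugate :: "('a, 'b) monoid_scheme \<Rightarrow> 'a \<Rightarrow> 'a set \<Rightarrow> 'a set" where
  "conjugate G g S = (\<lambda>s. g \<otimes>\<^bsub>G\<^esub> s \<otimes>\<^bsub>G\<^esub> inv\<^bsub>G\<^esub> g) ` S"

context group
begin

lemma conjugate_mult:
  assumes "g \<in> carrier G" "h \<in> carrier G" "S \<subseteq> carrier G"
  shows "conjugate G (g \<otimes> h) S = conjugate G g (conjugate G h S)"
  unfolding conjugate_def image_image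
  using assms by (intro image_cong refl) (auto simp: word_simps subset_iff)

lemma conjugate_one: "S \<subseteq> carrier G \<Longrightarrow> conjugate G \<one> S = S"
  unfolding conjugate_def by (force simp: subset_iff)

lemma conjugate_subset_carrier: "g \<in> carrier G \<Longrightarrow> S \<subseteq> carrier G \<Longrightarrow> conjugate G g S \<subseteq> carrier G"
  by (auto simp: conjugate_def)

lemma card_conjugate:
  assumes "g \<in> carrier G" "S \<subseteq> carrier G"
  shows "card (conjugate G g S) = card S"
  unfolding conjugate_def
proof (rule card_image, rule inj_onI)
  fix s t assume st: "s \<in> S" "t \<in> S" "g \<otimes> s \<otimes> inv g = g \<otimes> t \<otimes> inv g"
  thus "s = t" using assms by (auto simp: subset_iff)
qed

lemma subgroup_conjugate:
  assumes g: "g \<in> carrier G" and "subgroup S G"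
  shows "subgroup (conjugate G g S) G"
proof -
  interpret S: subgroup S G by fact
  show ?thesis
  proof (rule subgroupI)
    show "conjugate G g S \<subseteq> carrier G" using g S.subset by (rule conjugate_subset_carrier)
    show "conjugate G g S \<noteq> {}" using S.one_closed unfolding conjugate_def by blast
  next
    fix a assume "a \<in> conjugate G g S"
    then obtain s where s: "s \<in> S" "a = g \<otimes> s \<otimes> inv g" by (auto simp: conjugate_def)
    hence "inv a = g \<otimes> inv s \<otimes> inv g" using g by (simp add: word_simps)
    thus "inv a \<in> conjugate G g S" using s by (auto simp: conjugate_def)
  next
    fix a b assume "a \<in> conjugate G g S" "b \<in> conjugate G g S"
    then obtain s t where s: "s \<in> S" "a = g \<otimes> s \<otimes> inv g" "t \<in> S" "b = g \<otimes> t \<otimes> inv g"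
      by (auto simp: conjugate_def)
    hence "a \<otimes> b = g \<otimes> (s \<otimes> t) \<otimes> inv g" using g by (simp add: word_simps)
    thus "a \<otimes> b \<in> conjugate G g S" using s by (auto simp: conjugate_def)
  qed
qed

lemma subgroup_normalizer:
  assumes "S \<subseteq> carrier G"
  shows "subgroup {g \<in> carrier G. conjugate G g S = S} G"
proof (rule subgroupI)
  show "{g \<in> carrier G. conjugate G g S = S} \<noteq> {}"
    using conjugate_one[OF assms] by auto
next
  fix a assume a: "a \<in> {g \<in> carrier G. conjugate G g S = S}"
  hence "conjugate G (inv a) S = conjugate G (inv a) (conjugate G a S)" by simp
  also have "\<dots> = conjugate G (inv a \<otimes> a) S" using a assms by (intro conjugate_mult[symmetric]) auto
  also have "\<dots> = S" using a assms by (simp add: conjugate_one)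
  finally show "inv a \<in> {g \<in> carrier G. conjugate G g S = S}" using a by simp
qed (use assms in \<open>auto simp: conjugate_mult\<close>)

lemma conjugate_eqI:
  assumes "finite S" "g \<in> carrier G" "S \<subseteq> carrier G" "conjugate G g S \<subseteq> S"
  shows "conjugate G g S = S"
  using card_subset_eq[OF assms(1,4)] card_conjugate[OF assms(2,3)] by simp

lemma normal_if_conjugate:
  assumes "subgroup S G" "\<And>g. g \<in> carrier G \<Longrightarrow> conjugate G g S = S"
  shows "S \<lhd> G"
  unfolding normal_inv_iff using assms by (auto simp: conjugate_def)

text \<open>A \<open>p\<close>-group acting on a finite set of size prime to \<open>p\<close> has a fixed point.\<close>
lemma p_group_fixed_point:
  fixes act :: "'a \<Rightarrow> 'e \<Rightarrow> 'e"
  assumes P: "subgroup P G" "finite P" "card P = p ^ k" and p: "Factorial_Ring.prime p"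
    and E: "finite E" "\<not> p dvd card E"
    and closed: "\<And>g e. g \<in> P \<Longrightarrow> e \<in> E \<Longrightarrow> act g e \<in> E"
    and mult: "\<And>g h e. g \<in> P \<Longrightarrow> h \<in> P \<Longrightarrow> e \<in> E \<Longrightarrow> act (g \<otimes> h) e = act g (act h e)"
    and one: "\<And>e. e \<in> E \<Longrightarrow> act \<one> e = e"
  obtains e where "e \<in> E" "\<And>g. g \<in> P \<Longrightarrow> act g e = e"
proof -
  interpret P: subgroup P G by fact
  let ?P = "G\<lparr>carrier := P\<rparr>"
  have grp: "group ?P" using P.subgroup_is_group is_group by simp
  define \<phi> where "\<phi> g = (\<lambda>e\<in>E. act g e)" for g
  have bij: "bij_betw (act g) E E" if g: "g \<in> P" for g
  proof (rule bij_betw_byWitness[where f' = "act (inv g)"])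
    have "act (inv g) (act g e) = e" "act g (act (inv g) e) = e" if e: "e \<in> E" for e
      using mult[of "inv g" g e] mult[of g "inv g" e] one e g by auto
    thus "\<forall>a\<in>E. act (inv g) (act g a) = a" "\<forall>a'\<in>E. act g (act (inv g) a') = a'" by auto
  qed (use g closed in auto)
  have \<phi>_bij: "\<phi> g \<in> Bij E" if "g \<in> P" for g
    using bij[OF that] by (auto simp: \<phi>_def Bij_def bij_betw_def inj_on_def)
  have "\<phi> \<in> hom ?P (BijGroup E)"
  proof (rule homI)
    fix g h assume gh: "g \<in> carrier ?P" "h \<in> carrier ?P"
    have "\<phi> (g \<otimes> h) = compose E (\<phi> g) (\<phi> h)"
      using gh mult closed by (auto simp: \<phi>_def compose_def fun_eq_iff)
    thus "\<phi> (g \<otimes>\<^bsub>?P\<^esub> h) = \<phi> g \<otimes>\<^bsub>BijGroup E\<^esub> \<phi> h"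
      using \<phi>_bij gh by (simp add: BijGroup_def)
  qed (use \<phi>_bij in \<open>simp add: BijGroup_def\<close>)
  then interpret A: group_action ?P E \<phi>
    using grp group_BijGroup[of E] by (simp add: group_action_def group_hom_def group_hom_axioms_def)
  have fin_orb: "finite (orbits ?P E \<phi>)" "\<And>Ob. Ob \<in> orbits ?P E \<phi> \<Longrightarrow> finite Ob"
    using A.orbits_coverture E(1) finite_UnionD[of "orbits ?P E \<phi>"]
    by (simp, metis A.orbits_coverture E(1) Union_upper finite_subset)
  have "card E = (\<Sum>Ob\<in>orbits ?P E \<phi>. card Ob)"
    using A.disjoint_sum[OF E(1), of "\<lambda>_. 1::nat"] fin_orb by simp
  then obtain Ob where Ob: "Ob \<in> orbits ?P E \<phi>" "\<not> p dvd card Ob"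
    using E(2) dvd_sum by metis
  then obtain e where e: "e \<in> E" "Ob = orbit ?P \<phi> e" by (auto simp: orbits_def)
  have "card Ob * card (stabilizer ?P \<phi> e) = p ^ k"
    using A.orbit_stabilizer_theorem[OF e(1)] P(3) e(2) by (simp add: Coset.order_def)
  hence "card Ob dvd p ^ k" by (metis dvd_triv_left)
  then obtain j where "card Ob = p ^ j" using divides_primepow_nat[OF p] by auto
  hence "card Ob = 1" using Ob(2) by (cases j) auto
  then obtain e' where "Ob = {e'}" by (auto simp: card_1_singleton_iff)
  hence orb: "orbit ?P \<phi> e = {e}" using A.orbit_refl[OF e(1)] e(2) by auto
  have "act g e = e" if "g \<in> P" for g
  proof -
    have "\<phi> g e \<in> orbit ?P \<phi> e" using that by (auto simp: orbit_def)
    thus ?thesis using orb e(1) by (simp add: \<phi>_def)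
  qed
  thus ?thesis using that e(1) by blast
qed

lemma card_subgroup_dvd:
  assumes "subgroup S G" "subgroup T G" "S \<subseteq> T"
  shows "card S dvd card T"
proof -
  have "card (rcosets\<^bsub>G\<lparr>carrier := T\<rparr>\<^esub> S) * card S = card T"
    using group.lagrange[OF subgroup.subgroup_is_group[OF assms(2) is_group] subgroup_incl[OF assms]]
    by (simp add: Coset.order_def)
  thus ?thesis by (metis dvd_triv_right)
qed

text \<open>Sylow \<open>q\<close>-subgroups of \<open>N\<close> are conjugate: \<open>S'\<close> fixes one of the cosets of \<open>S\<close> in \<open>N\<close>.\<close>
lemma sylow_conjugate:
  assumes N: "subgroup N G" and fin: "finite N" and q: "Factorial_Ring.prime q" "card N = q ^ a * m" "\<not> q dvd m"
    and S: "subgroup S G" "S \<subseteq> N" "card S = q ^ a"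
    and S': "subgroup S' G" "S' \<subseteq> N" "card S' = q ^ a"
  obtains n where "n \<in> N" "conjugate G n S' = S"
proof -
  interpret N: subgroup N G by fact
  interpret S: subgroup S G by fact
  interpret S': subgroup S' G by fact
  let ?N = "G\<lparr>carrier := N\<rparr>"
  have grp: "group ?N" using N.subgroup_is_group is_group by simp
  define E where "E = (\<lambda>n. S #> n) ` N"
  have E_eq: "E = rcosets\<^bsub>?N\<^esub> S" by (auto simp: E_def RCOSETS_def r_coset_def)
  have finS: "finite S" "finite S'" using S S' fin finite_subset by blast+
  have "card E * card S = card N"
    using group.lagrange[OF grp, of S] subgroup_incl[OF S(1) N S(2)] by (simp add: E_eq Coset.order_def)
  hence "card E = m" using q S(3) prime_gt_0_nat by simp
  obtain e where e: "e \<in> E" "\<And>g. g \<in> S' \<Longrightarrow> e #> inv g = e"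
  proof (rule p_group_fixed_point[OF S'(1) finS(2) S'(3) q(1), of E "\<lambda>g C. C #> inv g"])
    show "finite E" using fin by (simp add: E_def)
    show "\<not> q dvd card E" using q(3) \<open>card E = m\<close> by simp
    fix g e assume g: "g \<in> S'" "e \<in> E"
    then obtain n where n: "n \<in> N" "e = S #> n" by (auto simp: E_def)
    have "e #> inv g = S #> (n \<otimes> inv g)" using n g coset_mult_assoc[OF S.subset] by simp
    moreover have "n \<otimes> inv g \<in> N" using n g S'(2) by auto
    ultimately show "e #> inv g \<in> E" by (auto simp: E_def)
  next
    fix g h e assume gh: "g \<in> S'" "h \<in> S'" "e \<in> E"
    then obtain n where n: "n \<in> N" "e = S #> n" by (auto simp: E_def)
    thus "e #> inv (g \<otimes> h) = e #> inv h #> inv g" using gh S.subset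
      by (simp add: coset_mult_assoc inv_mult_group m_assoc r_coset_subset_G)
  next
    fix e assume "e \<in> E"
    then obtain n where n: "n \<in> N" "e = S #> n" by (auto simp: E_def)
    thus "e #> inv \<one> = e" using S.subset by (simp add: r_coset_subset_G)
  qed blast
  then obtain n where n: "n \<in> N" "e = S #> n" by (auto simp: E_def)
  have nG: "n \<in> carrier G" using n by simp
  have "n \<otimes> g \<otimes> inv n \<in> S" if g: "g \<in> S'" for g
  proof -
    have "S #> n #> inv (inv g) = S #> n" using e(2)[of "inv g"] g n by simp
    hence "S #> (n \<otimes> g) = S #> n" using g nG S.subset by (simp add: coset_mult_assoc)
    hence "n \<otimes> g \<in> S #> n" using rcos_self[of "n \<otimes> g" S] g nG S(1) by simp
    then obtain s where "s \<in> S" "n \<otimes> g = s \<otimes> n" by (auto simp: r_coset_def)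
    thus ?thesis using nG by (simp add: m_assoc)
  qed
  hence "conjugate G n S' \<subseteq> S" by (auto simp: conjugate_def)
  hence "conjugate G n S' = S"
    using card_subset_eq[OF finS(1)] card_conjugate[OF nG S'.subset] S(3) S'(3) by simp
  thus ?thesis using that n(1) by blast
qed

text \<open>The normalizer condition for nilpotent quotients of \<open>Y\<close>: if \<open>T\<close> contains a term of the series of
  \<open>Y\<close> and is its own normalizer in \<open>Y\<close>, then, climbing the series, it contains every term.\<close>
lemma self_normalizing_in_nilpotent:
  assumes fin: "finite Y" and Y: "Y \<lhd> G" and low: "lower_central G Y m \<subseteq> T"
    and T: "subgroup T G" "T \<subseteq> Y"
    and self: "\<And>g. g \<in> Y \<Longrightarrow> conjugate G g T = T \<Longrightarrow> g \<in> T"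
  shows "T = Y"
proof -
  interpret Y: normal Y G by fact
  interpret T: subgroup T G by fact
  have "lower_central G Y (m - i) \<subseteq> T" for i
  proof (induction i)
    case (Suc i)
    show ?case
    proof (cases "i < m")
      case True
      define j where "j = m - Suc i"
      have j: "m - i = Suc j" using True by (simp add: j_def)
      have "g \<in> T" if g: "g \<in> lower_central G Y j" for g
      proof -
        have gY: "g \<in> Y" using g lower_central_antimono[OF Y, of 0 j] by auto
        hence gG: "g \<in> carrier G" by simp
        have "g \<otimes> t \<otimes> inv g \<in> T" if t: "t \<in> T" for t
        proof -
          have "g \<otimes> t \<otimes> inv g \<otimes> inv t \<in> T"
            using commutator_in_commutator_subgroup[OF g, of t Y] t T(2) Suc.IH
            unfolding j lower_central_Suc by blast
          hence "g \<otimes> t \<otimes> inv g \<otimes> inv t \<otimes> t \<in> T" using t by (rule T.m_closed)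
          thus ?thesis using gG t by (simp add: m_assoc)
        qed
        hence "conjugate G g T \<subseteq> T" by (auto simp: conjugate_def)
        hence "conjugate G g T = T" using conjugate_eqI[OF _ gG T.subset] fin T(2) finite_subset by blast
        thus ?thesis using self gY by blast
      qed
      thus ?thesis by (auto simp: j_def)
    qed (use Suc.IH in simp)
  qed (use low in simp)
  from this[of m] show ?thesis using T(2) by simp
qed

lemma maximal_subgroup_above:
  assumes fin: "finite M" and M: "subgroup M G" and K: "subgroup K G" "K \<subset> M"
  obtains H where "maximal_in G H M" "K \<subseteq> H"
proof -
  let ?A = "{H. subgroup H G \<and> H \<subset> M}"
  have "finite ?A" by (rule finite_subset[of _ "Pow M"]) (use fin in auto)
  then obtain H where H: "H \<in> ?A" "K \<subseteq> H" "\<forall>L\<in>?A. H \<subseteq> L \<longrightarrow> H = L"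
    using finite_has_maximal2[of ?A K] K by auto
  have "maximal_in G H M"
    unfolding maximal_in_def using H M by auto
  thus ?thesis using that H(2) by blast
qed

lemma centralizer_normal:
  assumes V: "V \<lhd> G" and Y: "Y \<lhd> G"
  shows "{v \<in> V. \<forall>y\<in>Y. v \<otimes> y = y \<otimes> v} \<lhd> G" (is "?C \<lhd> G")
proof -
  interpret V: normal V G by fact
  interpret Y: normal Y G by fact
  have sub: "subgroup ?C G"
  proof (rule subgroupI)
    have "\<one> \<in> ?C" using V.one_closed by auto
    thus "?C \<noteq> {}" by blast
  next
    fix a assume a: "a \<in> ?C"
    have "inv a \<otimes> y = y \<otimes> inv a" if y: "y \<in> Y" for y
    proof -
      have aG: "a \<in> carrier G" "y \<in> carrier G" using a y by auto
      have "inv a \<otimes> y = inv a \<otimes> (y \<otimes> a) \<otimes> inv a" using aG by (simp add: m_assoc)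
      also have "y \<otimes> a = a \<otimes> y" using a y by simp
      also have "inv a \<otimes> (a \<otimes> y) \<otimes> inv a = y \<otimes> inv a" using aG by (simp add: mult_cancel)
      finally show ?thesis .
    qed
    thus "inv a \<in> ?C" using a by simp
  next
    fix a b assume ab: "a \<in> ?C" "b \<in> ?C"
    have "a \<otimes> b \<otimes> y = y \<otimes> (a \<otimes> b)" if y: "y \<in> Y" for y
    proof -
      have "a \<otimes> b \<otimes> y = a \<otimes> (y \<otimes> b)" using ab y by (simp add: m_assoc)
      also have "\<dots> = y \<otimes> a \<otimes> b" using ab y by (simp add: m_assoc[symmetric])
      finally show ?thesis using ab y by (simp add: m_assoc)
    qed
    thus "a \<otimes> b \<in> ?C" using ab by simp
  qed auto
  show ?thesis
    unfolding normal_inv_iff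
  proof (intro conjI sub ballI)
    fix g a assume g: "g \<in> carrier G" and a: "a \<in> ?C"
    have "g \<otimes> a \<otimes> inv g \<otimes> y = y \<otimes> (g \<otimes> a \<otimes> inv g)" if y: "y \<in> Y" for y
    proof -
      have y': "inv g \<otimes> y \<otimes> g \<in> Y" using Y.inv_op_closed1 g y by simp
      have "g \<otimes> a \<otimes> inv g \<otimes> y = g \<otimes> (a \<otimes> (inv g \<otimes> y \<otimes> g)) \<otimes> inv g"
        using g a y by (simp add: word_simps)
      also have "a \<otimes> (inv g \<otimes> y \<otimes> g) = (inv g \<otimes> y \<otimes> g) \<otimes> a" using a y' by simp
      also have "g \<otimes> ((inv g \<otimes> y \<otimes> g) \<otimes> a) \<otimes> inv g = y \<otimes> (g \<otimes> a \<otimes> inv g)"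
        using g a y by (simp add: word_simps)
      finally show ?thesis .
    qed
    thus "g \<otimes> a \<otimes> inv g \<in> ?C" using g a V.inv_op_closed2 by simp
  qed
qed

text \<open>If \<open>Y/V\<close> is nilpotent, then \<open>G\<close> is the product of \<open>V\<close> and the normalizer of any Sylow subgroup \<open>S\<close>
  of \<open>Y\<close>. By the Frattini argument \<open>G\<close> is the product of \<open>Y\<close> and this normalizer, and \<open>Y\<close> is the product
  \<open>T\<close> of \<open>V\<close> and the normalizer of \<open>S\<close> in \<open>Y\<close>, because \<open>T\<close> is its own normalizer in \<open>Y\<close>.\<close>
lemma frattini_sylow:
  assumes fin: "finite (carrier G)" and Y: "Y \<lhd> G" and V: "V \<lhd> G" "V \<subseteq> Y"
    and low: "lower_central G Y m \<subseteq> V"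
    and q: "Factorial_Ring.prime q" "card Y = q ^ a * r" "\<not> q dvd r"
    and S: "subgroup S G" "S \<subseteq> Y" "card S = q ^ a"
    and g: "g \<in> carrier G"
  shows "\<exists>v\<in>V. \<exists>n\<in>{n \<in> carrier G. conjugate G n S = S}. g = v \<otimes> n"
proof -
  interpret Y: normal Y G by fact
  interpret V: normal V G by fact
  interpret S: subgroup S G by fact
  have finY: "finite Y" using fin Y.subset finite_subset by blast
  let ?N = "{g \<in> carrier G. conjugate G g S = S}"
  have N: "subgroup ?N G" by (rule subgroup_normalizer[OF S.subset])
  define T where "T = V <#> (?N \<inter> Y)"
  have NY: "subgroup (?N \<inter> Y) G" by (rule subgroups_Inter_pair[OF N Y.subgroup_axioms])
  have T: "subgroup T G" unfolding T_def by (rule mult_norm_subgroup[OF V(1) NY])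
  interpret T: subgroup T G by fact
  have TY: "T \<subseteq> Y" using V(2) Y.m_closed unfolding T_def set_mult_def by blast
  have VT: "V \<subseteq> T"
  proof
    fix v assume v: "v \<in> V"
    have "\<one> \<in> ?N \<inter> Y" by (rule subgroup.one_closed[OF NY])
    hence "v \<otimes> \<one> \<in> T" using v unfolding T_def set_mult_def by blast
    thus "v \<in> T" using v by simp
  qed
  have NYT: "?N \<inter> Y \<subseteq> T"
  proof
    fix n assume n: "n \<in> ?N \<inter> Y"
    hence "\<one> \<otimes> n \<in> T" using V.one_closed unfolding T_def set_mult_def by blast
    thus "n \<in> T" using n by simp
  qed
  have finT: "finite T" using finY TY finite_subset by blast
  have ST: "S \<subseteq> T"
  proof
    fix s assume s: "s \<in> S"
    have "conjugate G s S \<subseteq> S" using s by (auto simp: conjugate_def)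
    hence "conjugate G s S = S"
      using conjugate_eqI[of S s] s finite_subset[OF S(2) finY] S.subset by auto
    thus "s \<in> T" using NYT s S(2) by auto
  qed
  have cT: "\<exists>b. card T = q ^ a * b \<and> \<not> q dvd b"
  proof -
    have "card T dvd card Y"
      by (rule card_subgroup_dvd[OF T Y.subgroup_axioms TY])
    moreover have "card S dvd card T"
      by (rule card_subgroup_dvd[OF S(1) T ST])
    then obtain b where b: "card T = q ^ a * b" using S(3) by auto
    ultimately have "b dvd r" using q(1,2) prime_gt_0_nat[OF q(1)] by simp
    thus ?thesis using b q(3) dvd_trans by blast
  qed
  have "T = Y"
  proof (rule self_normalizing_in_nilpotent[OF finY Y order.trans[OF low VT] T TY])
    fix y assume y: "y \<in> Y" "conjugate G y T = T"
    have yG: "y \<in> carrier G" using y(1) by simp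
    obtain b where b: "card T = q ^ a * b" "\<not> q dvd b" using cT by blast
    have "conjugate G y S \<subseteq> T" using y(2) ST unfolding conjugate_def by blast
    then obtain t where t: "t \<in> T" "conjugate G t (conjugate G y S) = S"
      using sylow_conjugate[OF T finT q(1) b S(1) ST S(3) subgroup_conjugate[OF yG S(1)]]
        card_conjugate[OF yG S.subset] S(3) by metis
    have tG: "t \<in> carrier G" using t(1) by simp
    have "conjugate G (t \<otimes> y) S = S" using conjugate_mult[OF tG yG S.subset] t(2) by simp
    hence "t \<otimes> y \<in> ?N \<inter> Y" using tG yG t(1) TY y(1) by auto
    hence "t \<otimes> y \<in> T" using NYT by blast
    thus "y \<in> T" using subgroup_mult_mem_iff[OF T t(1) yG] by simp
  qed
  have "conjugate G g S \<subseteq> Y" using S(2) Y.inv_op_closed2 g by (auto simp: conjugate_def)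
  then obtain n where n: "n \<in> Y" "conjugate G n (conjugate G g S) = S"
    using sylow_conjugate[OF Y.subgroup_axioms finY q S subgroup_conjugate[OF g S(1)]]
      card_conjugate[OF g S.subset] S(3) by metis
  have nG: "n \<in> carrier G" using n(1) by simp
  have ng: "n \<otimes> g \<in> ?N" using conjugate_mult[OF nG g S.subset] n(2) nG g by simp
  have "inv n \<in> T" using n(1) \<open>T = Y\<close> by simp
  then obtain v k where vk: "v \<in> V" "k \<in> ?N" "inv n = v \<otimes> k" unfolding T_def set_mult_def by auto
  have "g = inv n \<otimes> (n \<otimes> g)" using nG g by (simp add: mult_cancel)
  hence "g = v \<otimes> (k \<otimes> (n \<otimes> g))" using vk nG g by (simp add: m_assoc)
  moreover have "k \<otimes> (n \<otimes> g) \<in> ?N" using subgroup.m_closed[OF N vk(2) ng] .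
  ultimately show ?thesis using vk(1) by (intro bexI)
qed

lemma prime_power_if_unique_prime:
  fixes n p :: nat
  assumes "n > 0" "Factorial_Ring.prime p" "\<And>q. Factorial_Ring.prime q \<Longrightarrow> q dvd n \<Longrightarrow> q = p"
  obtains k where "n = p ^ k"
proof -
  obtain k r where kr: "n = p ^ k * r" "\<not> p dvd r"
    using multiplicity_decompose'[of n p] assms(1,2) by (metis gr_implies_not0 not_prime_unit mult.commute)
  have "r = 1"
  proof (rule ccontr)
    assume "r \<noteq> 1"
    then obtain q where q: "Factorial_Ring.prime q" "q dvd r" using prime_factor_nat by blast
    hence "q = p" using assms(3) kr(1) by simp
    thus False using q kr(2) by simp
  qed
  thus ?thesis using that kr by simp
qed

text \<open>Not all Sylow subgroups of \<open>Y\<close> are normal in \<open>G\<close>: otherwise each of them would be trivial or contain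
  \<open>V\<close>, so \<open>Y\<close> would be a \<open>p\<close>-group and would centralize \<open>V\<close>. A maximal subgroup containing the
  normalizer of a non-normal Sylow subgroup is a complement of \<open>V\<close>.\<close>
lemma maximal_complement:
  assumes fin: "finite (carrier G)" and V: "V \<lhd> G" "V \<noteq> {\<one>}"
    and comm: "\<And>v w. v \<in> V \<Longrightarrow> w \<in> V \<Longrightarrow> v \<otimes> w = w \<otimes> v"
    and min: "\<And>L. L \<lhd> G \<Longrightarrow> L \<noteq> {\<one>} \<Longrightarrow> V \<subseteq> L"
    and Y: "Y \<lhd> G" "V \<subseteq> Y" and low: "lower_central G Y m \<subseteq> V"
    and nc: "\<not> (\<forall>v\<in>V. \<forall>y\<in>Y. v \<otimes> y = y \<otimes> v)"
  obtains M where "maximal_in G M (carrier G)" "V \<inter> M = {\<one>}"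
    "\<And>g. g \<in> carrier G \<Longrightarrow> \<exists>v\<in>V. \<exists>m\<in>M. g = v \<otimes> m"
proof -
  interpret Y: normal Y G by fact
  interpret V: normal V G by fact
  have finY: "finite Y" using fin Y.subset finite_subset by blast
  have finV: "finite V" using finY Y(2) finite_subset by blast
  have cY: "card Y > 0" using finY Y.one_closed card_gt_0_iff by blast
  have grpY: "group (G\<lparr>carrier := Y\<rparr>)" using Y.subgroup_is_group[OF is_group] .
  have sylow: "\<exists>S. subgroup S G \<and> S \<subseteq> Y \<and> card S = q ^ a"
    if "Factorial_Ring.prime q" "card Y = q ^ a * r" for q a r
  proof -
    have "\<exists>H. subgroup H (G\<lparr>carrier := Y\<rparr>) \<and> card H = q ^ a"
      by (rule sylow_thm[OF that(1) grpY, of a r]) (use that finY in \<open>simp_all add: Coset.order_def\<close>)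
    thus ?thesis using subgroup_restrict_iff[OF is_group Y.subgroup_axioms] by blast
  qed
  have "\<exists>q a r S. Factorial_Ring.prime q \<and> card Y = q ^ a * r \<and> \<not> q dvd r \<and> subgroup S G \<and> S \<subseteq> Y \<and>
          card S = q ^ a \<and> \<not> S \<lhd> G"
  proof (rule ccontr)
    assume neg: "\<not> ?thesis"
    have "card V \<noteq> 1" using V(2) V.one_closed by (metis One_nat_def card_1_singleton_iff singletonD)
    then obtain p where p: "Factorial_Ring.prime p" "p dvd card V" using prime_factor_nat by blast
    have unique: "q = p" if q: "Factorial_Ring.prime q" "q dvd card Y" for q
    proof -
      obtain a r where ar: "card Y = q ^ a * r" "\<not> q dvd r"
        using multiplicity_decompose'[of "card Y" q] cY q(1) by (metis gr_implies_not0 not_prime_unit mult.commute)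
      obtain S where S: "subgroup S G" "S \<subseteq> Y" "card S = q ^ a" using sylow[OF q(1) ar(1)] by blast
      have norm: "S \<lhd> G" using neg q(1) ar S by blast
      have "a \<noteq> 0" using ar q(2) by (cases a) auto
      hence "card S \<noteq> 1" using S(3) prime_gt_1_nat[OF q(1)] by simp
      hence "S \<noteq> {\<one>}" by auto
      hence "V \<subseteq> S" using min norm by blast
      hence "card V dvd card S"
        using card_subgroup_dvd[OF V.subgroup_axioms S(1)] by simp
      hence "p dvd q ^ a" using p(2) S(3) dvd_trans by metis
      thus "q = p" using p(1) q(1) prime_dvd_power primes_dvd_imp_eq by metis
    qed
    obtain k where k: "card Y = p ^ k" using prime_power_if_unique_prime[OF cY p(1) unique] by blast
    obtain e where e: "e \<in> V - {\<one>}" "\<And>y. y \<in> Y \<Longrightarrow> y \<otimes> e \<otimes> inv y = e"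
    proof (rule p_group_fixed_point[OF Y.subgroup_axioms finY k p(1), of "V - {\<one>}" "\<lambda>g v. g \<otimes> v \<otimes> inv g"])
      show "finite (V - {\<one>})" using finV by simp
      have "card V > 0" using finV V.one_closed card_gt_0_iff by blast
      moreover have "card (V - {\<one>}) = card V - 1" using V.one_closed by simp
      ultimately have "card V = card (V - {\<one>}) + 1" by simp
      thus "\<not> p dvd card (V - {\<one>})"
        using p dvd_add_right_iff[of p "card (V - {\<one>})" 1] not_prime_unit by auto
      fix g v assume g: "g \<in> Y" and v: "v \<in> V - {\<one>}"
      have "g \<otimes> v \<otimes> inv g \<noteq> \<one>"
      proof
        assume "g \<otimes> v \<otimes> inv g = \<one>"
        hence "inv g \<otimes> (g \<otimes> v \<otimes> inv g) \<otimes> g = \<one>" using g by simp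
        thus False using g v by (simp add: word_simps)
      qed
      thus "g \<otimes> v \<otimes> inv g \<in> V - {\<one>}" using V.inv_op_closed2 g v by auto
    next
      fix g h v assume "g \<in> Y" "h \<in> Y" "v \<in> V - {\<one>}"
      thus "g \<otimes> h \<otimes> v \<otimes> inv (g \<otimes> h) = g \<otimes> (h \<otimes> v \<otimes> inv h) \<otimes> inv g" by (simp add: word_simps)
    qed auto
    have "e \<in> {v \<in> V. \<forall>y\<in>Y. v \<otimes> y = y \<otimes> v}"
    proof (intro CollectI conjI ballI)
      fix y assume y: "y \<in> Y"
      have "e \<otimes> y = y \<otimes> e \<otimes> inv y \<otimes> y" using e(2)[OF y] by simp
      thus "e \<otimes> y = y \<otimes> e" using y e(1) by (simp add: m_assoc)
    qed (use e in simp)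
    hence "{v \<in> V. \<forall>y\<in>Y. v \<otimes> y = y \<otimes> v} \<noteq> {\<one>}" using e(1) by blast
    hence "V \<subseteq> {v \<in> V. \<forall>y\<in>Y. v \<otimes> y = y \<otimes> v}" using min centralizer_normal[OF V(1) Y(1)] by blast
    thus False using nc by blast
  qed
  then obtain q a r S where q: "Factorial_Ring.prime q" "card Y = q ^ a * r" "\<not> q dvd r"
    and S: "subgroup S G" "S \<subseteq> Y" "card S = q ^ a" and nn: "\<not> S \<lhd> G" by blast
  let ?N = "{g \<in> carrier G. conjugate G g S = S}"
  have N: "subgroup ?N G" by (rule subgroup_normalizer[OF subgroup.subset[OF S(1)]])
  have "?N \<noteq> carrier G" using nn normal_if_conjugate[OF S(1)] by blast
  hence "?N \<subset> carrier G" by blast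
  then obtain M where M: "maximal_in G M (carrier G)" "?N \<subseteq> M"
    using maximal_subgroup_above[OF fin subgroup_self N] by blast
  have subM: "subgroup M G" "M \<noteq> carrier G" using M(1) by (auto simp: maximal_in_def)
  interpret M: subgroup M G by (rule subM(1))
  have dec: "\<exists>v\<in>V. \<exists>m\<in>M. g = v \<otimes> m" if g: "g \<in> carrier G" for g
  proof -
    obtain v n where vn: "v \<in> V" "n \<in> ?N" "g = v \<otimes> n"
      using frattini_sylow[OF fin Y(1) V(1) Y(2) low q S g] by (elim bexE)
    have "n \<in> M" by (rule subsetD[OF M(2) vn(2)])
    thus ?thesis by (intro bexI[OF _ vn(1)] bexI[of _ n] vn(3))
  qed
  have nVM: "\<not> V \<subseteq> M"
  proof
    assume VM: "V \<subseteq> M"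
    have "carrier G \<subseteq> M" using dec VM M.m_closed by blast
    thus False using subM(2) M.subset by blast
  qed
  have "V \<inter> M \<lhd> G"
    unfolding normal_inv_iff
  proof (intro conjI ballI)
    show "subgroup (V \<inter> M) G" by (rule subgroups_Inter_pair[OF V.subgroup_axioms subM(1)])
    fix g w assume g: "g \<in> carrier G" and w: "w \<in> V \<inter> M"
    obtain v m where vm: "v \<in> V" "m \<in> M" "g = v \<otimes> m" using dec[OF g] by blast
    have c: "m \<otimes> w \<otimes> inv m \<in> V" "m \<otimes> w \<otimes> inv m \<in> M" using w vm V.inv_op_closed2 by auto
    have "g \<otimes> w \<otimes> inv g = v \<otimes> (m \<otimes> w \<otimes> inv m) \<otimes> inv v"
      using vm w by (simp add: word_simps)
    also have "v \<otimes> (m \<otimes> w \<otimes> inv m) = (m \<otimes> w \<otimes> inv m) \<otimes> v" using comm vm(1) c(1) by blast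
    also have "(m \<otimes> w \<otimes> inv m) \<otimes> v \<otimes> inv v = m \<otimes> w \<otimes> inv m" using vm w by (simp add: m_assoc)
    finally show "g \<otimes> w \<otimes> inv g \<in> V \<inter> M" using c by simp
  qed
  hence "V \<inter> M = {\<one>}" using min[of "V \<inter> M"] nVM by blast
  thus ?thesis using that[OF M(1) _ dec] by blast
qed

end

lemma (in group) subgroup_set_mult_normalized:
  assumes U: "subgroup U G" and H: "subgroup H G"
    and norm: "\<And>h u. h \<in> H \<Longrightarrow> u \<in> U \<Longrightarrow> h \<otimes> u \<otimes> inv h \<in> U"
  shows "subgroup (U <#> H) G"
proof -
  interpret U: subgroup U G by fact
  interpret H: subgroup H G by fact
  have mem: "u \<otimes> h \<in> U <#> H" if "u \<in> U" "h \<in> H" for u h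
    using that unfolding set_mult_def by blast
  show ?thesis
  proof (rule subgroupI)
    show "U <#> H \<subseteq> carrier G" by (auto simp: set_mult_def)
    show "U <#> H \<noteq> {}" using mem[OF U.one_closed H.one_closed] by blast
  next
    fix a assume "a \<in> U <#> H"
    then obtain u h where uh: "u \<in> U" "h \<in> H" "a = u \<otimes> h" by (auto simp: set_mult_def)
    have "inv a = (inv h \<otimes> inv u \<otimes> inv (inv h)) \<otimes> inv h" using uh by (simp add: word_simps)
    thus "inv a \<in> U <#> H" using mem norm[of "inv h" "inv u"] uh by simp
  next
    fix a b assume "a \<in> U <#> H" "b \<in> U <#> H"
    then obtain u h u' h' where uh: "u \<in> U" "h \<in> H" "a = u \<otimes> h" "u' \<in> U" "h' \<in> H" "b = u' \<otimes> h'"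
      by (auto simp: set_mult_def)
    have "a \<otimes> b = (u \<otimes> (h \<otimes> u' \<otimes> inv h)) \<otimes> (h \<otimes> h')" using uh by (simp add: word_simps)
    thus "a \<otimes> b \<in> U <#> H" using mem norm[of h u'] uh by simp
  qed
qed

lemma (in group) generate_conjugate_closed:
  assumes S: "S \<subseteq> carrier G" and g: "g \<in> carrier G"
    and conj: "\<And>s. s \<in> S \<Longrightarrow> g \<otimes> s \<otimes> inv g \<in> generate G S"
    and u: "u \<in> generate G S"
  shows "g \<otimes> u \<otimes> inv g \<in> generate G S"
proof -
  have "subgroup (conjugate G (inv g) (generate G S)) G"
    by (rule subgroup_conjugate[OF _ generate_is_subgroup[OF S]]) (use g in simp)
  moreover have "S \<subseteq> conjugate G (inv g) (generate G S)"
  proof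
    fix s assume s: "s \<in> S"
    have "s = inv g \<otimes> (g \<otimes> s \<otimes> inv g) \<otimes> inv (inv g)" using g s S by (auto simp: word_simps)
    thus "s \<in> conjugate G (inv g) (generate G S)" unfolding conjugate_def using conj[OF s] by blast
  qed
  ultimately have "u \<in> conjugate G (inv g) (generate G S)"
    using generate_subgroup_incl u by blast
  then obtain w where w: "w \<in> generate G S" "u = inv g \<otimes> w \<otimes> inv (inv g)" by (auto simp: conjugate_def)
  have "w \<in> carrier G" using generate_incl[OF S] w(1) by blast
  hence "g \<otimes> u \<otimes> inv g = w" using w(2) g by (simp add: word_simps)
  thus ?thesis using w(1) by simp
qed

section \<open>The action of a complement in a primitive WSM-group\<close>

text \<open>\<open>V\<close> is the unique minimal normal subgroup of the WSM-group \<open>G\<close>, it is abelian, and the maximal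
  subgroup \<open>M\<close> is a complement of \<open>V\<close>. The group \<open>M\<close> acts on \<open>V\<close> by conjugation.\<close>
locale primitive_WSM = group G for G (structure) +
  fixes V M
  assumes fin: "finite (carrier G)"
    and WSM: "WSM_group G"
    and V: "V \<lhd> G" and V_nontrivial: "V \<noteq> {\<one>}"
    and V_comm: "\<And>v w. v \<in> V \<Longrightarrow> w \<in> V \<Longrightarrow> v \<otimes> w = w \<otimes> v"
    and V_min: "\<And>L. L \<lhd> G \<Longrightarrow> L \<noteq> {\<one>} \<Longrightarrow> V \<subseteq> L"
    and M_max: "maximal_in G M (carrier G)"
    and VM: "V \<inter> M = {\<one>}"
    and decompose: "\<And>g. g \<in> carrier G \<Longrightarrow> \<exists>v\<in>V. \<exists>m\<in>M. g = v \<otimes> m"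
begin

sublocale V: normal V G by (rule V)
sublocale M: subgroup M G using M_max by (simp add: maximal_in_def)

lemma finV: "finite V" and finM: "finite M"
  using fin V.subset M.subset finite_subset by blast+

lemma V_conj: "v \<in> V \<Longrightarrow> u \<in> V \<Longrightarrow> v \<otimes> u \<otimes> inv v = u"
  using V_comm[of v u] by (simp add: m_assoc)

text \<open>A maximal subgroup \<open>L\<close> containing \<open>VH\<close> has \<open>H\<close> as a maximal subgroup by the WSM property. As
  \<open>UH\<close> lies between \<open>H\<close> and \<open>L\<close> and is not \<open>H\<close>, it contains \<open>V\<close>.\<close>
lemma irreducible_under_maximal:
  assumes H: "maximal_in G H M" and U: "subgroup U G" "U \<subseteq> V" "U \<noteq> {\<one>}"
    and inv: "\<And>h u. h \<in> H \<Longrightarrow> u \<in> U \<Longrightarrow> h \<otimes> u \<otimes> inv h \<in> U"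
  shows "U = V"
proof -
  have subH: "subgroup H G" "H \<subset> M" using H by (auto simp: maximal_in_def)
  interpret H: subgroup H G by (rule subH(1))
  interpret U: subgroup U G by (rule U(1))
  have VH: "subgroup (V <#> H) G" by (rule mult_norm_subgroup[OF V subH(1)])
  have "V <#> H \<noteq> carrier G"
  proof
    assume eq: "V <#> H = carrier G"
    have "m \<in> H" if m: "m \<in> M" for m
    proof -
      have "m \<in> V <#> H" using eq m by simp
      then obtain v h where vh: "v \<in> V" "h \<in> H" "m = v \<otimes> h" by (auto simp: set_mult_def)
      have "v = m \<otimes> inv h" using vh by (simp add: m_assoc)
      moreover have "m \<otimes> inv h \<in> M" using m vh(2) subH(2) by blast
      ultimately have "v \<in> V \<inter> M" using vh(1) by simp
      hence "v = \<one>" using VM by simp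
      thus ?thesis using vh by simp
    qed
    thus False using subH(2) by blast
  qed
  hence "V <#> H \<subset> carrier G" using subgroup.subset[OF VH] by blast
  then obtain L where L: "maximal_in G L (carrier G)" "V <#> H \<subseteq> L"
    using maximal_subgroup_above[OF fin subgroup_self VH] by blast
  have mem: "u \<otimes> h \<in> U <#> H" if "u \<in> U" "h \<in> H" for u h
    using that unfolding set_mult_def by blast
  have HU: "H \<subseteq> U <#> H" using mem[OF U.one_closed] by force
  have UUH: "U \<subseteq> U <#> H" using mem[OF _ H.one_closed] by force
  have UHL: "U <#> H \<subseteq> L" using L(2) U(2) unfolding set_mult_def by blast
  have "maximal_in G H L"
    using WSM H M_max L(1) order.trans[OF HU UHL] unfolding WSM_group_iff[OF is_group] by blast
  hence "U <#> H = H \<or> U <#> H = L"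
    using subgroup_set_mult_normalized[OF U(1) subH(1) inv] HU UHL by (simp add: maximal_in_def)
  thus ?thesis
  proof
    assume "U <#> H = H"
    hence "U \<subseteq> V \<inter> M" using UUH U(2) subH(2) by blast
    thus ?thesis using U(3) U.one_closed VM by blast
  next
    assume eq: "U <#> H = L"
    have "v \<in> U" if v: "v \<in> V" for v
    proof -
      have "v \<otimes> \<one> \<in> V <#> H" using v H.one_closed unfolding set_mult_def by blast
      hence "v \<in> U <#> H" using eq L(2) v by auto
      then obtain u h where uh: "u \<in> U" "h \<in> H" "v = u \<otimes> h" by (auto simp: set_mult_def)
      have "h = inv u \<otimes> v" using uh by (simp add: mult_cancel)
      hence "h \<in> V \<inter> M" using uh(1,2) v U(2) subH(2) by auto
      hence "h = \<one>" using VM by simp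
      thus ?thesis using uh by simp
    qed
    thus ?thesis using U(2) by blast
  qed
qed

lemma irreducible:
  assumes U: "subgroup U G" "U \<subseteq> V" "U \<noteq> {\<one>}"
    and inv: "\<And>m u. m \<in> M \<Longrightarrow> u \<in> U \<Longrightarrow> m \<otimes> u \<otimes> inv m \<in> U"
  shows "U = V"
proof -
  have "g \<otimes> u \<otimes> inv g \<in> U" if g: "g \<in> carrier G" and u: "u \<in> U" for g u
  proof -
    obtain v m where vm: "v \<in> V" "m \<in> M" "g = v \<otimes> m" using decompose[OF g] by blast
    have uG: "u \<in> carrier G" using u U(2) by auto
    have "g \<otimes> u \<otimes> inv g = v \<otimes> (m \<otimes> u \<otimes> inv m) \<otimes> inv v" using vm uG by (simp add: word_simps)
    also have "\<dots> = m \<otimes> u \<otimes> inv m" using V_conj[OF vm(1)] inv[OF vm(2) u] U(2) by blast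
    finally show ?thesis using inv[OF vm(2) u] by simp
  qed
  hence "U \<lhd> G" using U(1) by (simp add: normal_inv_iff)
  thus ?thesis using V_min U by blast
qed

lemma faithful:
  assumes m: "m \<in> M" and c: "\<And>v. v \<in> V \<Longrightarrow> m \<otimes> v = v \<otimes> m"
  shows "m = \<one>"
proof (rule ccontr)
  assume "m \<noteq> \<one>"
  let ?Z = "{z \<in> carrier G. \<forall>v\<in>V. z \<otimes> v = v \<otimes> z}"
  have Z: "?Z \<lhd> G" by (rule centralizer_normal[OF normal_self V])
  have norm: "?Z \<inter> M \<lhd> G"
    unfolding normal_inv_iff
  proof (intro conjI ballI)
    show "subgroup (?Z \<inter> M) G" by (rule subgroups_Inter_pair[OF normal_imp_subgroup[OF Z] M.subgroup_axioms])
    fix g z assume g: "g \<in> carrier G" and z: "z \<in> ?Z \<inter> M"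
    obtain v n where vn: "v \<in> V" "n \<in> M" "g = v \<otimes> n" using decompose[OF g] by blast
    have zZ: "z \<in> ?Z" and zM: "z \<in> M" using z by blast+
    have z': "n \<otimes> z \<otimes> inv n \<in> ?Z" by (rule normal.inv_op_closed2[OF Z M.mem_carrier[OF vn(2)] zZ])
    have z'': "n \<otimes> z \<otimes> inv n \<in> M" using zM vn(2) by simp
    have "g \<otimes> z \<otimes> inv g = v \<otimes> (n \<otimes> z \<otimes> inv n) \<otimes> inv v" using vn zM by (simp add: word_simps)
    also have "v \<otimes> (n \<otimes> z \<otimes> inv n) = (n \<otimes> z \<otimes> inv n) \<otimes> v"
      using bspec[OF conjunct2[OF CollectD[OF z']] vn(1)] by (rule sym)
    also have "(n \<otimes> z \<otimes> inv n) \<otimes> v \<otimes> inv v = n \<otimes> z \<otimes> inv n" using vn zM by (simp add: m_assoc)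
    finally show "g \<otimes> z \<otimes> inv g \<in> ?Z \<inter> M" using z' z'' by (simp only: IntI)
  qed
  have "m \<in> ?Z \<inter> M" by (intro IntI CollectI conjI ballI c m M.mem_carrier)
  hence "?Z \<inter> M \<noteq> {\<one>}" using \<open>m \<noteq> \<one>\<close> by (metis singletonD)
  hence "V \<subseteq> ?Z \<inter> M" by (rule V_min[OF norm])
  hence "V \<subseteq> M" by (rule order.trans[OF _ Int_lower2])
  thus False using VM V_nontrivial V.one_closed by blast
qed

text \<open>Let \<open>D\<close> be a stabilizer in \<open>A\<close>, of largest possible order, of some nontrivial element \<open>w\<close> of \<open>V\<close>.
  By the choice of \<open>D\<close>, distinct conjugates of \<open>D\<close> have no common nontrivial fixed point, and
  their groups of fixed points are even independent. If \<open>D\<close> were not normal in \<open>M\<close>, a maximal subgroup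
  \<open>H\<close> of \<open>M\<close> would contain its normalizer; the fixed points of the \<open>H\<close>-conjugates of \<open>D\<close> generate \<open>V\<close>,
  which leaves no room for those of a further conjugate. Hence \<open>D\<close> is normal in \<open>M\<close>, fixes \<open>V\<close>
  pointwise, and is trivial.\<close>
lemma abelian_normal_fixed_point_free:
  assumes A: "subgroup A G" "A \<subseteq> M" and Acomm: "\<And>a b. a \<in> A \<Longrightarrow> b \<in> A \<Longrightarrow> a \<otimes> b = b \<otimes> a"
    and Anorm: "\<And>m a. m \<in> M \<Longrightarrow> a \<in> A \<Longrightarrow> m \<otimes> a \<otimes> inv m \<in> A"
    and a: "a \<in> A" "a \<noteq> \<one>" and v: "v \<in> V" "a \<otimes> v = v \<otimes> a"
  shows "v = \<one>"
proof (rule ccontr)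
  assume v1: "v \<noteq> \<one>"
  interpret A: subgroup A G by (rule A(1))
  have finA: "finite A" using finM A(2) finite_subset by blast
  define stab where "stab w = {a \<in> A. a \<otimes> w = w \<otimes> a}" for w
  define fixed where "fixed E = {v \<in> V. \<forall>d\<in>E. d \<otimes> v = v \<otimes> d}" for E
  have card_le: "card (stab w) \<le> card A" for w
    by (rule card_mono[OF finA]) (auto simp: stab_def)
  obtain w where w: "w \<in> V" "w \<noteq> \<one>" and wmax: "\<And>u. u \<in> V \<Longrightarrow> u \<noteq> \<one> \<Longrightarrow> card (stab u) \<le> card (stab w)"
    using ex_has_greatest_nat[of "\<lambda>u. u \<in> V \<and> u \<noteq> \<one>" v "\<lambda>u. card (stab u)" "Suc (card A)"] v(1) v1
      le_imp_less_Suc[OF card_le] by blast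
  define D where "D = stab w"
  have DA: "D \<subseteq> A" by (auto simp: D_def stab_def)
  have DG: "D \<subseteq> carrier G" using DA A.subset by blast
  have finD: "finite D" using DA finA finite_subset by blast
  \<comment> \<open>the stabilizer of \<open>v\<close> contains \<open>a\<close>, so the largest stabilizer is not trivial\<close>
  have D1: "\<exists>d\<in>D. d \<noteq> \<one>"
  proof (rule ccontr)
    assume "\<not> ?thesis"
    hence "card D \<le> card {\<one>}" by (intro card_mono) auto
    moreover have "card {\<one>, a} \<le> card (stab v)"
      using v a finA A.one_closed by (intro card_mono) (auto simp: stab_def)
    ultimately show False using wmax[OF v(1) v1] a(2) by (simp add: D_def)
  qed
  have fixed_sub: "subgroup (fixed E) G" if E: "E \<subseteq> carrier G" for E
  proof (rule subgroupI)
    have "\<one> \<in> fixed E" using E by (auto simp: fixed_def)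
    thus "fixed E \<noteq> {}" by blast
  next
    fix b assume b: "b \<in> fixed E"
    have bG: "b \<in> carrier G" using b by (auto simp: fixed_def)
    have "d \<otimes> inv b = inv b \<otimes> d" if d: "d \<in> E" for d
    proof -
      have dG: "d \<in> carrier G" using d E by blast
      have "d \<otimes> inv b = inv b \<otimes> (b \<otimes> d) \<otimes> inv b" using bG dG by (simp add: mult_cancel)
      also have "b \<otimes> d = d \<otimes> b" using b d by (simp add: fixed_def)
      also have "inv b \<otimes> (d \<otimes> b) \<otimes> inv b = inv b \<otimes> d" using bG dG by (simp add: m_assoc)
      finally show ?thesis .
    qed
    thus "inv b \<in> fixed E" using b by (simp add: fixed_def)
  next
    fix b c assume b: "b \<in> fixed E" and c: "c \<in> fixed E"
    have G: "b \<in> carrier G" "c \<in> carrier G" using b c by (auto simp: fixed_def)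
    have "d \<otimes> (b \<otimes> c) = b \<otimes> c \<otimes> d" if d: "d \<in> E" for d
    proof -
      have dG: "d \<in> carrier G" using d E by blast
      have "d \<otimes> (b \<otimes> c) = b \<otimes> (d \<otimes> c)" using b d G dG by (simp add: m_assoc[symmetric] fixed_def)
      also have "\<dots> = b \<otimes> (c \<otimes> d)" using c d by (simp add: fixed_def)
      finally show ?thesis using G dG by (simp add: m_assoc)
    qed
    thus "b \<otimes> c \<in> fixed E" using b c by (simp add: fixed_def)
  qed (auto simp: fixed_def)
  have fixed_V: "fixed E \<subseteq> V" for E by (auto simp: fixed_def)
  have fixed_conj: "m \<otimes> u \<otimes> inv m \<in> fixed (conjugate G m E)"
    if m: "m \<in> M" and E: "E \<subseteq> carrier G" and u: "u \<in> fixed E" for m u E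
  proof -
    have uG: "u \<in> carrier G" using u by (auto simp: fixed_def)
    have "(m \<otimes> d \<otimes> inv m) \<otimes> (m \<otimes> u \<otimes> inv m) = (m \<otimes> u \<otimes> inv m) \<otimes> (m \<otimes> d \<otimes> inv m)"
      if d: "d \<in> E" for d
    proof -
      have dG: "d \<in> carrier G" using d E by blast
      have "(m \<otimes> d \<otimes> inv m) \<otimes> (m \<otimes> u \<otimes> inv m) = m \<otimes> (d \<otimes> u) \<otimes> inv m"
        using m uG dG by (simp add: word_simps)
      also have "d \<otimes> u = u \<otimes> d" using u d by (simp add: fixed_def)
      also have "m \<otimes> (u \<otimes> d) \<otimes> inv m = (m \<otimes> u \<otimes> inv m) \<otimes> (m \<otimes> d \<otimes> inv m)"
        using m uG dG by (simp add: word_simps)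
      finally show ?thesis .
    qed
    moreover have "m \<otimes> u \<otimes> inv m \<in> V" using V.inv_op_closed2 m u by (auto simp: fixed_def)
    ultimately show ?thesis by (auto simp: fixed_def conjugate_def)
  qed
  have conj_A: "conjugate G m D \<subseteq> A" if "m \<in> M" for m
    using that DA Anorm by (auto simp: conjugate_def)
  have card_conj: "card (conjugate G m D) = card D" if "m \<in> M" for m
    using card_conjugate[of m D] that DG by simp
  \<comment> \<open>a common fixed point would have a stabilizer equal to both conjugates\<close>
  have distinct: "u = \<one>" if mn: "m \<in> M" "n \<in> M" "conjugate G m D \<noteq> conjugate G n D"
    and u: "u \<in> fixed (conjugate G m D)" "u \<in> fixed (conjugate G n D)" for m n u
  proof (rule ccontr)
    assume "u \<noteq> \<one>"
    hence le: "card (stab u) \<le> card D" using wmax u(1) by (auto simp: D_def fixed_def)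
    have fs: "finite (stab u)" using finA by (auto simp: stab_def)
    have "conjugate G k D = stab u" if "k \<in> M" "u \<in> fixed (conjugate G k D)" for k
    proof (rule card_seteq[OF fs])
      show "conjugate G k D \<subseteq> stab u" using conj_A[OF that(1)] that(2) by (auto simp: stab_def fixed_def)
      show "card (stab u) \<le> card (conjugate G k D)" using le card_conj[OF that(1)] by simp
    qed
    thus False using mn u by metis
  qed
  have gen_carrier: "(\<Union>(fixed ` \<S>)) \<subseteq> carrier G" for \<S> using fixed_V V.subset by blast
  have gen_V: "generate G (\<Union>(fixed ` \<S>)) \<subseteq> V" for \<S>
    by (rule generate_subgroup_incl[OF _ V.subgroup_axioms]) (use fixed_V in blast)
  have indep: "u = \<one>"
    if "finite \<S>" "\<S> \<subseteq> (\<lambda>m. conjugate G m D) ` M" "n \<in> M" "conjugate G n D \<notin> \<S>"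
      "u \<in> generate G (\<Union>(fixed ` \<S>))" "u \<in> fixed (conjugate G n D)" for \<S> n u
    using that
  proof (induction \<S> arbitrary: n u rule: finite_induct)
    case empty
    thus ?case using generate_empty by simp
  next
    case (insert E \<S>)
    obtain k where k: "k \<in> M" "E = conjugate G k D" using insert.prems(1) by blast
    have EA: "E \<subseteq> A" "E \<subseteq> carrier G" using conj_A[OF k(1)] k(2) A.subset by auto
    let ?P = "generate G (\<Union>(fixed ` \<S>))"
    have Psub: "subgroup ?P G" by (rule generate_is_subgroup[OF gen_carrier])
    have PV: "?P \<subseteq> V" by (rule gen_V)
    have sub: "subgroup (fixed E <#> ?P) G"
    proof (rule subgroup_set_mult_normalized[OF fixed_sub[OF EA(2)] Psub])
      fix h u assume "h \<in> ?P" "u \<in> fixed E"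
      moreover have "h \<otimes> u \<otimes> inv h = u" by (rule V_conj) (use calculation PV fixed_V in blast)+
      ultimately show "h \<otimes> u \<otimes> inv h \<in> fixed E" by simp
    qed
    have "\<Union>(fixed ` insert E \<S>) \<subseteq> fixed E <#> ?P"
    proof
      fix y assume "y \<in> \<Union>(fixed ` insert E \<S>)"
      then consider "y \<in> fixed E" | "y \<in> \<Union>(fixed ` \<S>)" by auto
      thus "y \<in> fixed E <#> ?P"
      proof cases
        case 1
        have "y \<otimes> \<one> \<in> fixed E <#> ?P" unfolding set_mult_def using 1 subgroup.one_closed[OF Psub] by blast
        thus ?thesis using 1 by (auto simp: fixed_def)
      next
        case 2
        have "\<one> \<otimes> y \<in> fixed E <#> ?P" unfolding set_mult_def
          using generate.incl[OF 2] subgroup.one_closed[OF fixed_sub[OF EA(2)]] by blast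
        thus ?thesis using 2 by (auto simp: fixed_def)
      qed
    qed
    hence "generate G (\<Union>(fixed ` insert E \<S>)) \<subseteq> fixed E <#> ?P"
      using sub by (rule generate_subgroup_incl)
    then obtain e y where ey: "e \<in> fixed E" "y \<in> ?P" "u = e \<otimes> y"
      using insert.prems(4) by (auto simp: set_mult_def)
    have eV: "e \<in> V" and yV: "y \<in> V" using ey PV fixed_V by auto
    have uV: "u \<in> V" using insert.prems(5) fixed_V by blast
    \<comment> \<open>\<open>[d, u] = [d, y]\<close> lies in both groups of the induction hypothesis, so \<open>d\<close> fixes \<open>u\<close>\<close>
    have "d \<otimes> u = u \<otimes> d" if d: "d \<in> E" for d
    proof -
      have dA: "d \<in> A" using d EA by blast
      have dM: "d \<in> M" using dA A(2) by blast
      have dG: "d \<in> carrier G" using dA by simp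
      have conj_fixed: "d \<otimes> z \<otimes> inv d \<in> fixed F" if F: "F \<subseteq> A" and z: "z \<in> fixed F" for z F
      proof -
        have "d \<otimes> f \<otimes> inv d = f" if "f \<in> A" for f
          using Acomm[OF dA that] that dG by (simp add: m_assoc)
        hence "conjugate G d F = F" using F by (force simp: conjugate_def)
        thus ?thesis using fixed_conj[OF dM _ z] F A.subset by auto
      qed
      have "d \<otimes> y \<otimes> inv d \<in> ?P"
      proof (rule generate_conjugate_closed[OF gen_carrier dG _ ey(2)])
        fix z assume "z \<in> \<Union>(fixed ` \<S>)"
        then obtain F where F: "F \<in> \<S>" "z \<in> fixed F" by blast
        have "F \<subseteq> A" using F(1) insert.prems(1) conj_A by blast
        hence "d \<otimes> z \<otimes> inv d \<in> fixed F" using conj_fixed F(2) by blast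
        thus "d \<otimes> z \<otimes> inv d \<in> ?P" using F(1) by (intro generate.incl) blast
      qed
      hence dyP: "d \<otimes> y \<otimes> inv d \<otimes> inv y \<in> ?P"
        using ey(2) subgroup.m_closed[OF Psub] subgroup.m_inv_closed[OF Psub] by blast
      have de: "d \<otimes> e \<otimes> inv d = e" using ey(1) d dG eV by (simp add: fixed_def m_assoc)
      have dyV: "d \<otimes> y \<otimes> inv d \<in> V" using V.inv_op_closed2 dG yV by blast
      have "d \<otimes> u \<otimes> inv d = (d \<otimes> e \<otimes> inv d) \<otimes> (d \<otimes> y \<otimes> inv d)"
        using ey(3) eV yV dG by (simp add: word_simps)
      hence "d \<otimes> u \<otimes> inv d \<otimes> inv u = e \<otimes> ((d \<otimes> y \<otimes> inv d) \<otimes> inv y) \<otimes> inv e"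
        using de ey(3) eV yV dyV by (simp add: inv_mult_group m_assoc)
      also have "\<dots> = d \<otimes> y \<otimes> inv d \<otimes> inv y"
        by (rule V_conj[OF eV]) (use dyV yV in simp)
      finally have eq: "d \<otimes> u \<otimes> inv d \<otimes> inv u = d \<otimes> y \<otimes> inv d \<otimes> inv y" .
      have "d \<otimes> u \<otimes> inv d \<in> fixed (conjugate G n D)"
        using conj_fixed conj_A insert.prems(2,5) by blast
      moreover have fs: "subgroup (fixed (conjugate G n D)) G"
        using fixed_sub conj_A insert.prems(2) A.subset by (meson order.trans)
      ultimately have "d \<otimes> u \<otimes> inv d \<otimes> inv u \<in> fixed (conjugate G n D)"
        using insert.prems(5) subgroup.m_closed[OF fs] subgroup.m_inv_closed[OF fs] by blast
      hence "d \<otimes> u \<otimes> inv d \<otimes> inv u = \<one>"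
        using insert.IH[of n "d \<otimes> u \<otimes> inv d \<otimes> inv u"] insert.prems dyP eq by auto
      hence "d \<otimes> u \<otimes> inv d \<otimes> inv u \<otimes> (u \<otimes> d) = u \<otimes> d" using uV dG by simp
      thus ?thesis using uV dG by (simp add: word_simps)
    qed
    hence "u \<in> fixed (conjugate G k D)" using uV k(2) by (simp add: fixed_def)
    thus ?case using distinct[OF k(1) insert.prems(2) _ _ insert.prems(5)] insert.prems(3) k(2) by blast
  qed
  have wD: "w \<in> fixed D" using w(1) by (auto simp: fixed_def D_def stab_def)
  let ?I = "{m \<in> carrier G. conjugate G m D = D} \<inter> M"
  have I: "subgroup ?I G" by (rule subgroups_Inter_pair[OF subgroup_normalizer[OF DG] M.subgroup_axioms])
  show False
  proof (cases "?I = M")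
    case True
    have "fixed D = V"
    proof (rule irreducible[OF fixed_sub[OF DG] fixed_V])
      show "fixed D \<noteq> {\<one>}" using wD w(2) by blast
      fix m u assume m: "m \<in> M" and u: "u \<in> fixed D"
      have "conjugate G m D = D" using True m by blast
      thus "m \<otimes> u \<otimes> inv m \<in> fixed D" using fixed_conj[OF m DG u] by simp
    qed
    hence "d = \<one>" if "d \<in> D" for d
      using faithful[of d] that DA A(2) by (auto simp: fixed_def)
    thus False using D1 by blast
  next
    case False
    hence "?I \<subset> M" by blast
    then obtain H where H: "maximal_in G H M" "?I \<subseteq> H"
      using maximal_subgroup_above[OF finM M.subgroup_axioms I] by blast
    have subH: "subgroup H G" "H \<subset> M" using H(1) by (auto simp: maximal_in_def)
    interpret H: subgroup H G by (rule subH(1))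
    let ?D = "(\<lambda>h. conjugate G h D) ` H"
    let ?U = "generate G (\<Union>(fixed ` ?D))"
    have "fixed D \<subseteq> ?U"
    proof
      fix u assume u: "u \<in> fixed D"
      have "D = conjugate G \<one> D" by (simp add: conjugate_one[OF DG])
      hence "D \<in> ?D" using H.one_closed by blast
      thus "u \<in> ?U" using u by (intro generate.incl) blast
    qed
    hence wU: "w \<in> ?U" using wD by blast
    have UV: "?U = V"
    proof (rule irreducible_under_maximal[OF H(1) generate_is_subgroup[OF gen_carrier] gen_V])
      show "?U \<noteq> {\<one>}" using wU w(2) by blast
      fix h u assume h: "h \<in> H" and u: "u \<in> ?U"
      show "h \<otimes> u \<otimes> inv h \<in> ?U"
      proof (rule generate_conjugate_closed[OF gen_carrier _ _ u])
        show "h \<in> carrier G" using h by simp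
        fix s assume "s \<in> \<Union>(fixed ` ?D)"
        then obtain k where k: "k \<in> H" "s \<in> fixed (conjugate G k D)" by blast
        have "h \<otimes> s \<otimes> inv h \<in> fixed (conjugate G h (conjugate G k D))"
          using fixed_conj[of h "conjugate G k D" s] h k subH(2) conjugate_subset_carrier[OF _ DG] by auto
        also have "conjugate G h (conjugate G k D) = conjugate G (h \<otimes> k) D"
          using conjugate_mult[of h k D] h k DG by simp
        finally show "h \<otimes> s \<otimes> inv h \<in> ?U" using h k by (intro generate.incl) blast
      qed
    qed
    obtain m where m: "m \<in> M" "m \<notin> H" using subH(2) by blast
    have "conjugate G m D \<notin> ?D"
    proof
      assume "conjugate G m D \<in> ?D"
      then obtain h where h: "h \<in> H" "conjugate G m D = conjugate G h D" by blast
      have "conjugate G (inv h \<otimes> m) D = conjugate G (inv h) (conjugate G h D)"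
        using conjugate_mult[of "inv h" m D] h m(1) DG by simp
      also have "\<dots> = D"
        using conjugate_mult[of "inv h" h D] h DG by (simp add: conjugate_one)
      finally have "conjugate G (inv h \<otimes> m) D = D" .
      moreover have "inv h \<otimes> m \<in> M" using M.m_closed[OF _ m(1)] H.m_inv_closed[OF h(1)] subH(2) by blast
      ultimately have "inv h \<otimes> m \<in> H" using H(2) by auto
      hence "m \<in> H" using subgroup_mult_mem_iff[OF subH(1), of "inv h" m] h m(1) by simp
      thus False using m(2) by blast
    qed
    moreover have "m \<otimes> w \<otimes> inv m \<in> fixed (conjugate G m D)" by (rule fixed_conj[OF m(1) DG wD])
    moreover have "m \<otimes> w \<otimes> inv m \<in> ?U" unfolding UV using V.inv_op_closed2 m(1) w(1) by simp
    moreover have "finite ?D" using finM subH(2) finite_subset by blast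
    ultimately have "m \<otimes> w \<otimes> inv m = \<one>" using indep[of ?D m] m(1) subH(2) by blast
    hence "inv m \<otimes> (m \<otimes> w \<otimes> inv m) \<otimes> m = \<one>" using m(1) by simp
    thus False using w m(1) by (simp add: word_simps)
  qed
qed

end

section \<open>Fixed-point-free actions of abelian groups\<close>

context comm_group
begin

lemma finprod_swap:
  assumes "finite A" "finite B" "\<And>i j. i \<in> A \<Longrightarrow> j \<in> B \<Longrightarrow> f i j \<in> carrier G"
  shows "(\<Otimes>i\<in>A. \<Otimes>j\<in>B. f i j) = (\<Otimes>j\<in>B. \<Otimes>i\<in>A. f i j)"
  using assms(1,3)
proof (induction A rule: finite_induct)
  case (insert a A)
  have "(\<Otimes>i\<in>insert a A. \<Otimes>j\<in>B. f i j) = (\<Otimes>j\<in>B. f a j) \<otimes> (\<Otimes>i\<in>A. \<Otimes>j\<in>B. f i j)"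
    using insert by (intro finprod_insert) (auto intro!: finprod_closed)
  also have "\<dots> = (\<Otimes>j\<in>B. f a j) \<otimes> (\<Otimes>j\<in>B. \<Otimes>i\<in>A. f i j)" using insert by simp
  also have "\<dots> = (\<Otimes>j\<in>B. f a j \<otimes> (\<Otimes>i\<in>A. f i j))"
    using insert by (intro finprod_multf[symmetric]) (auto intro!: finprod_closed)
  also have "\<dots> = (\<Otimes>j\<in>B. \<Otimes>i\<in>insert a A. f i j)"
    using insert by (intro finprod_cong' refl finprod_insert[symmetric]) (auto intro!: finprod_closed)
  finally show ?case .
qed simp

lemma endomorphism_finprod:
  assumes \<gamma>: "\<gamma> \<in> hom G G" and "finite A" "\<And>i. i \<in> A \<Longrightarrow> f i \<in> carrier G"
  shows "\<gamma> (\<Otimes>i\<in>A. f i) = (\<Otimes>i\<in>A. \<gamma> (f i))"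
  using assms(2,3)
proof (induction A rule: finite_induct)
  case empty
  show ?case using hom_one[OF \<gamma> is_group is_group] by simp
next
  case (insert a A)
  have c: "f a \<in> carrier G" "f \<in> A \<rightarrow> carrier G" using insert.prems by auto
  have c': "\<gamma> (f a) \<in> carrier G" "(\<lambda>i. \<gamma> (f i)) \<in> A \<rightarrow> carrier G" using c \<gamma> by (auto simp: hom_def)
  have "\<gamma> (\<Otimes>i\<in>insert a A. f i) = \<gamma> (f a \<otimes> (\<Otimes>i\<in>A. f i))"
    using insert.hyps c by simp
  also have "\<dots> = \<gamma> (f a) \<otimes> \<gamma> (\<Otimes>i\<in>A. f i)"
    using c by (intro hom_mult[OF \<gamma>] finprod_closed) auto
  also have "\<dots> = (\<Otimes>i\<in>insert a A. \<gamma> (f i))"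
    using insert c c' by simp
  finally show ?case .
qed

lemma endomorphism_funpow: "\<gamma> \<in> hom G G \<Longrightarrow> \<gamma> ^^ n \<in> hom G G"
  by (induction n) (auto simp: hom_def Pi_def)

text \<open>The product of the orbit of \<open>v\<close> is a fixed point of \<open>\<gamma>\<close>, hence trivial.\<close>
lemma fixed_point_free_norm:
  assumes \<gamma>: "\<gamma> \<in> hom G G" and q: "q > 0" "\<And>u. u \<in> carrier G \<Longrightarrow> (\<gamma> ^^ q) u = u"
    and free: "\<And>u. u \<in> carrier G \<Longrightarrow> \<gamma> u = u \<Longrightarrow> u = \<one>" and v: "v \<in> carrier G"
  shows "(\<Otimes>i\<in>{..<q}. (\<gamma> ^^ i) v) = \<one>"
proof -
  obtain r where r: "q = Suc r" using q(1) by (cases q) auto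
  have c: "(\<gamma> ^^ i) v \<in> carrier G" for i
    using hom_in_carrier[OF endomorphism_funpow[OF \<gamma>] v] .
  let ?P = "\<Otimes>i\<in>{..r}. (\<gamma> ^^ i) v" and ?Q = "\<Otimes>i\<in>{..r}. (\<gamma> ^^ Suc i) v"
  have P: "?P \<in> carrier G" by (rule finprod_closed, rule Pi_I, rule c)
  have Q: "?Q \<in> carrier G" using c[of "Suc _"] by (intro finprod_closed Pi_I)
  have "?Q \<otimes> (\<gamma> ^^ 0) v = (\<Otimes>i\<in>{..Suc r}. (\<gamma> ^^ i) v)"
    by (rule finprod_Suc2[symmetric], rule Pi_I, rule c)
  also have "\<dots> = (\<gamma> ^^ Suc r) v \<otimes> ?P" by (rule finprod_Suc, rule Pi_I, rule c)
  also have "(\<gamma> ^^ Suc r) v = v" using q(2)[OF v] r by simp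
  finally have "?Q \<otimes> v = v \<otimes> ?P" by simp
  hence 1: "?Q = ?P" using P Q v by (simp add: m_comm)
  have 2: "\<gamma> ?P = ?Q" using endomorphism_finprod[OF \<gamma>, of "{..r}" "\<lambda>i. (\<gamma> ^^ i) v"] c by simp
  have "?P = \<one>" by (rule free[OF P trans[OF 2 1]])
  thus ?thesis using r by (simp add: lessThan_Suc_atMost)
qed

text \<open>Here \<open>\<alpha>\<close> and \<open>\<beta>\<close> generate an action of \<open>C\<^sub>q \<times> C\<^sub>q\<close>. Multiplying the norms of \<open>v\<close> under
  \<open>\<alpha>\<^sup>i \<beta>\<close> for \<open>i < q\<close>, all of which are trivial, and exchanging the products gives \<open>v\<^sup>q\<close> times
  norms under the nontrivial powers of \<open>\<alpha>\<close>, which are trivial as well.\<close>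
lemma commuting_fixed_point_free:
  assumes \<alpha>: "\<alpha> \<in> hom G G" and \<beta>: "\<beta> \<in> hom G G"
    and comm: "\<And>u. u \<in> carrier G \<Longrightarrow> \<alpha> (\<beta> u) = \<beta> (\<alpha> u)"
    and q: "q > 0" "\<And>u. u \<in> carrier G \<Longrightarrow> (\<alpha> ^^ q) u = u" "\<And>u. u \<in> carrier G \<Longrightarrow> (\<beta> ^^ q) u = u"
    and free1: "\<And>j u. 0 < j \<Longrightarrow> j < q \<Longrightarrow> u \<in> carrier G \<Longrightarrow> (\<alpha> ^^ j) u = u \<Longrightarrow> u = \<one>"
    and free2: "\<And>i u. i < q \<Longrightarrow> u \<in> carrier G \<Longrightarrow> (\<alpha> ^^ i) (\<beta> u) = u \<Longrightarrow> u = \<one>"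
    and v: "v \<in> carrier G"
  shows "v [^] q = \<one>"
proof -
  have ca: "(\<alpha> ^^ i) u \<in> carrier G" if "u \<in> carrier G" for i u
    using hom_in_carrier[OF endomorphism_funpow[OF \<alpha>] that] .
  have cb: "(\<beta> ^^ i) u \<in> carrier G" if "u \<in> carrier G" for i u
    using hom_in_carrier[OF endomorphism_funpow[OF \<beta>] that] .
  have cb1: "\<beta> u \<in> carrier G" if "u \<in> carrier G" for u using hom_in_carrier[OF \<beta> that] .
  have comm': "(\<alpha> ^^ i) (\<beta> u) = \<beta> ((\<alpha> ^^ i) u)" if u: "u \<in> carrier G" for i u
  proof (induction i)
    case (Suc i)
    thus ?case using comm[OF ca[OF u]] by simp
  qed simp
  have pow: "((\<lambda>u. (\<alpha> ^^ i) (\<beta> u)) ^^ j) u = (\<alpha> ^^ (i * j)) ((\<beta> ^^ j) u)" if u: "u \<in> carrier G" for i j u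
  proof (induction j)
    case (Suc j)
    have "((\<lambda>u. (\<alpha> ^^ i) (\<beta> u)) ^^ Suc j) u = (\<alpha> ^^ i) (\<beta> ((\<alpha> ^^ (i * j)) ((\<beta> ^^ j) u)))"
      using Suc by simp
    also have "\<beta> ((\<alpha> ^^ (i * j)) ((\<beta> ^^ j) u)) = (\<alpha> ^^ (i * j)) (\<beta> ((\<beta> ^^ j) u))"
      using comm'[OF cb[OF u]] by simp
    finally show ?case by (simp add: funpow_add)
  qed simp
  have pow_id: "(\<alpha> ^^ (i * q)) u = u" if u: "u \<in> carrier G" for i u
    by (induction i) (simp_all add: funpow_add q(2)[OF u])
  have norm1: "(\<Otimes>j\<in>{..<q}. ((\<lambda>u. (\<alpha> ^^ i) (\<beta> u)) ^^ j) v) = \<one>" if i: "i < q" for i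
  proof (rule fixed_point_free_norm[OF _ q(1) _ _ v])
    show "(\<lambda>u. (\<alpha> ^^ i) (\<beta> u)) \<in> hom G G"
      using endomorphism_funpow[OF \<alpha>, of i] \<beta> by (auto simp: hom_def Pi_def)
    show "((\<lambda>u. (\<alpha> ^^ i) (\<beta> u)) ^^ q) u = u" if u: "u \<in> carrier G" for u
      unfolding pow[OF u] using q(3)[OF u] pow_id[OF u] by simp
  qed (use free2[OF i] in blast)
  have "(\<Otimes>i\<in>{..<q}. \<Otimes>j\<in>{..<q}. (\<alpha> ^^ (i * j)) ((\<beta> ^^ j) v)) = \<one>"
    by (rule finprod_one_eqI, rule norm1[unfolded pow[OF v]]) simp
  hence "\<one> = (\<Otimes>j\<in>{..<q}. \<Otimes>i\<in>{..<q}. (\<alpha> ^^ (i * j)) ((\<beta> ^^ j) v))"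
    using finprod_swap[of "{..<q}" "{..<q}" "\<lambda>i j. (\<alpha> ^^ (i * j)) ((\<beta> ^^ j) v)"] ca cb v by simp
  also have "\<dots> = (\<Otimes>j\<in>{..<q}. if 0 = j then v [^] q else \<one>)"
  proof (rule finprod_cong')
    fix j assume "j \<in> {..<q}"
    hence j: "j < q" by simp
    show "(\<Otimes>i\<in>{..<q}. (\<alpha> ^^ (i * j)) ((\<beta> ^^ j) v)) = (if 0 = j then v [^] q else \<one>)"
    proof (cases "j = 0")
      case True
      thus ?thesis using finprod_const[OF v, of "{..<q}"] by simp
    next
      case False
      have eq: "(\<alpha> ^^ (i * j)) = ((\<alpha> ^^ j) ^^ i)" for i by (simp add: funpow_mult mult.commute)
      have "(\<Otimes>i\<in>{..<q}. ((\<alpha> ^^ j) ^^ i) ((\<beta> ^^ j) v)) = \<one>"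
      proof (rule fixed_point_free_norm[OF endomorphism_funpow[OF \<alpha>] q(1) _ _ cb[OF v]])
        show "((\<alpha> ^^ j) ^^ q) u = u" if "u \<in> carrier G" for u
          using pow_id[OF that, of j] by (simp add: funpow_mult mult.commute)
      qed (use free1[of j] False j in blast)
      thus ?thesis using False by (simp add: eq)
    qed
  qed (use v in auto)
  also have "\<dots> = v [^] q"
    using finprod_singleton[of 0 "{..<q}" "\<lambda>_. v [^] q"] q(1) v by simp
  finally show ?thesis by simp
qed

end

context primitive_WSM
begin

text \<open>If the conjugate \<open>b\<close> of \<open>a\<close> were not a power of \<open>a\<close>, then \<open>a\<close> and \<open>b\<close> would make \<open>C\<^sub>q \<times> C\<^sub>q\<close> act on \<open>V\<close>
  without fixed points, so that \<open>V\<close> would have exponent \<open>q\<close>; but an action of a \<open>q\<close>-group on a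
  nontrivial \<open>q\<close>-group has nontrivial fixed points.\<close>
lemma prime_order_conjugate:
  fixes q :: nat
  assumes A: "subgroup A G" "A \<subseteq> M" and Acomm: "\<And>a b. a \<in> A \<Longrightarrow> b \<in> A \<Longrightarrow> a \<otimes> b = b \<otimes> a"
    and Anorm: "\<And>m a. m \<in> M \<Longrightarrow> a \<in> A \<Longrightarrow> m \<otimes> a \<otimes> inv m \<in> A"
    and a: "a \<in> A" "a \<noteq> \<one>" and q: "Factorial_Ring.prime q" "a [^] q = \<one>" and m: "m \<in> M"
  shows "m \<otimes> a \<otimes> inv m \<in> generate G {a}"
proof (rule ccontr)
  assume notin: "m \<otimes> a \<otimes> inv m \<notin> generate G {a}"
  interpret A: subgroup A G by (rule A(1))
  define b where "b = m \<otimes> a \<otimes> inv m"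
  have aG: "a \<in> carrier G" using a(1) by simp
  have bA: "b \<in> A" unfolding b_def using Anorm m a(1) by blast
  have bG: "b \<in> carrier G" using bA by simp
  have gen: "subgroup (generate G {a}) G" using generate_is_subgroup[of "{a}"] aG by simp
  have a_gen: "a [^] (k::nat) \<in> generate G {a}" for k
    by (induction k) (auto intro: generate.one generate.eng generate.incl)
  have powA: "a [^] (k::nat) \<in> A" for k using a(1) by (induction k) auto
  have b_pow: "b [^] (k::nat) = m \<otimes> a [^] k \<otimes> inv m" for k
    using m aG by (induction k) (simp_all add: b_def word_simps)
  have bq: "b [^] q = \<one>" using b_pow[of q] q(2) m by simp
  note free = abelian_normal_fixed_point_free[OF A Acomm Anorm]
  define act where "act g u = g \<otimes> u \<otimes> inv g" for g u
  let ?V = "G\<lparr>carrier := V\<rparr>"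
  have grpV: "group ?V" using V.subgroup_is_group[OF is_group] .
  interpret CV: comm_group ?V
    by (rule group.group_comm_groupI[OF grpV]) (use V_comm in simp)
  have act_hom: "act g \<in> hom ?V ?V" if g: "g \<in> carrier G" for g
    unfolding hom_def act_def using V.inv_op_closed2[OF g] g by (auto simp: word_simps)
  have act_mult: "act g (act h u) = act (g \<otimes> h) u" if "g \<in> carrier G" "h \<in> carrier G" "u \<in> V" for g h u
    using that by (simp add: act_def word_simps)
  have act_pow: "(act g ^^ k) u = act (g [^] k) u" if g: "g \<in> carrier G" and u: "u \<in> V" for g u k
  proof (induction k)
    case 0
    show ?case using u by (simp add: act_def)
  next
    case (Suc k)
    thus ?case using act_mult[of g "g [^] k" u] g u unfolding nat_pow_Suc2[OF g] by simp
  qed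
  have act_fix: "g \<otimes> u = u \<otimes> g" if "act g u = u" "g \<in> carrier G" "u \<in> V" for g u
  proof -
    have "g \<otimes> u = g \<otimes> u \<otimes> inv g \<otimes> g" using that(2,3) by (simp add: m_assoc)
    thus ?thesis using that(1) by (simp add: act_def)
  qed
  have act_free: "u = \<one>" if "act g u = u" "g \<in> A" "g \<noteq> \<one>" "u \<in> V" for g u
    using free[of g u] act_fix[of g u] that by simp
  have ord_a: "ord a = q"
  proof -
    have "ord a dvd q" using pow_eq_id[OF aG, of q] q(2) by simp
    moreover have "ord a \<noteq> 1" using ord_eq_1[OF aG] a(2) by simp
    ultimately show ?thesis using q(1) prime_nat_iff by blast
  qed
  have a_pow: "a [^] j \<noteq> \<one>" if "0 < j" "j < q" for j
    using pow_eq_id[OF aG, of j] ord_a that nat_dvd_not_less by auto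
  have v_pow: "v [^] q = \<one>" if v: "v \<in> V" for v
  proof -
    have "v [^]\<^bsub>?V\<^esub> q = \<one>\<^bsub>?V\<^esub>"
    proof (rule CV.commuting_fixed_point_free[OF act_hom[OF aG] act_hom[OF bG]])
      show "q > 0" using q(1) prime_gt_0_nat by blast
      show "v \<in> carrier ?V" using v by simp
      fix u assume "u \<in> carrier ?V"
      hence u: "u \<in> V" by simp
      show "act a (act b u) = act b (act a u)"
        using act_mult aG bG u Acomm[OF a(1) bA] by simp
      show "(act a ^^ q) u = u" "(act b ^^ q) u = u"
        using act_pow aG bG u q(2) bq by (simp_all add: act_def)
      show "u = \<one>\<^bsub>?V\<^esub>" if "0 < j" "j < q" "(act a ^^ j) u = u" for j
        using act_free[of "a [^] j" u] that act_pow[OF aG u] powA a_pow u by simp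
      show "u = \<one>\<^bsub>?V\<^esub>" if "i < q" "(act a ^^ i) (act b u) = u" for i
      proof -
        have "act b u \<in> V" using V.inv_op_closed2 bG u by (simp add: act_def)
        hence "act (a [^] i \<otimes> b) u = u"
          using that(2) act_pow[OF aG] act_mult aG bG u by simp
        moreover have "a [^] i \<otimes> b \<noteq> \<one>"
        proof
          assume "a [^] i \<otimes> b = \<one>"
          hence "b = inv (a [^] i)" using inv_equality[of b "a [^] i"] aG bG
            by (metis Acomm bA inv_equality nat_pow_closed powA)
          hence "b \<in> generate G {a}" using subgroup.m_inv_closed[OF gen a_gen] by simp
          thus False using notin by (simp add: b_def)
        qed
        ultimately show ?thesis using act_free[of "a [^] i \<otimes> b" u] powA bA u by simp
      qed
    qed
    thus ?thesis by (simp add: nat_pow_consistent[symmetric])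
  qed
  \<comment> \<open>so \<open>q\<close> divides the order of \<open>V\<close>, and \<open>a\<close> has a fixed point among the other elements of \<open>V\<close>\<close>
  obtain v where v: "v \<in> V" "v \<noteq> \<one>" using V_nontrivial V.one_closed by auto
  have vG: "v \<in> carrier G" using v(1) by simp
  have "ord v dvd q" using pow_eq_id[OF vG, of q] v_pow[OF v(1)] by simp
  moreover have "ord v \<noteq> 1" using ord_eq_1[OF vG] v(2) by simp
  ultimately have ord_v: "ord v = q" using q(1) prime_nat_iff by blast
  have subv: "subgroup (generate G {v}) G" using generate_is_subgroup[of "{v}"] vG by simp
  have "generate G {v} \<subseteq> V" by (rule generate_subgroup_incl[OF _ V.subgroup_axioms]) (use v in simp)
  hence "card (generate G {v}) dvd card V" by (rule card_subgroup_dvd[OF subv V.subgroup_axioms])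
  hence qV: "q dvd card V" using generate_pow_card[OF vG] ord_v by simp
  have cV: "card V > 0" using finV V.one_closed card_gt_0_iff by blast
  have "card (V - {\<one>}) = card V - 1" using V.one_closed by simp
  hence "card V = card (V - {\<one>}) + 1" using cV by simp
  hence nq: "\<not> q dvd card (V - {\<one>})"
    using qV dvd_add_right_iff[of q "card (V - {\<one>})" 1] q(1) not_prime_unit by auto
  have gen_A: "generate G {a} \<subseteq> A" by (rule generate_subgroup_incl[OF _ A(1)]) (use a in simp)
  have gen_fin: "finite (generate G {a})" by (rule finite_subset[OF order.trans[OF gen_A A(2)] finM])
  have gen_card: "card (generate G {a}) = q ^ 1" using generate_pow_card[OF aG] ord_a by simp
  obtain e where e: "e \<in> V - {\<one>}" "\<And>g. g \<in> generate G {a} \<Longrightarrow> act g e = e"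
  proof (rule p_group_fixed_point[OF gen gen_fin gen_card q(1) _ nq, of act])
    show "finite (V - {\<one>})" using finV by simp
    fix g u assume g: "g \<in> generate G {a}" and u: "u \<in> V - {\<one>}"
    have gG: "g \<in> carrier G" using g gen_A A.subset by blast
    have "act g u \<noteq> \<one>"
    proof
      assume "act g u = \<one>"
      hence "inv g \<otimes> (g \<otimes> u \<otimes> inv g) \<otimes> g = \<one>" using gG by (simp add: act_def)
      thus False using gG u by (simp add: word_simps)
    qed
    thus "act g u \<in> V - {\<one>}" using V.inv_op_closed2[OF gG] u by (simp add: act_def)
  next
    fix g h u assume "g \<in> generate G {a}" "h \<in> generate G {a}" "u \<in> V - {\<one>}"
    moreover from this have "g \<in> carrier G" "h \<in> carrier G" using gen_A A.subset by blast+
    ultimately show "act (g \<otimes> h) u = act g (act h u)" using act_mult by simp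
  next
    fix u assume "u \<in> V - {\<one>}"
    thus "act \<one> u = u" by (simp add: act_def)
  qed blast
  have "act a e = e" using e(2) generate.incl[of a "{a}" G] by simp
  thus False using act_free[of a e] a e(1) by simp
qed

end

section \<open>Vanishing elements outside the Fitting subgroup\<close>

context group
begin

text \<open>The elements of \<open>Y\<close> that centralize \<open>W\<close> modulo \<open>V\<close>.\<close>
lemma commutator_centralizer_normal:
  assumes V: "V \<lhd> G" and W: "W \<lhd> G" and Y: "Y \<lhd> G"
  shows "{g \<in> Y. \<forall>f\<in>W. f \<otimes> g \<otimes> inv f \<otimes> inv g \<in> V} \<lhd> G" (is "?Z \<lhd> G")
proof -
  interpret V: normal V G by fact
  interpret W: normal W G by fact
  interpret Y: normal Y G by fact
  have sub: "subgroup ?Z G"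
  proof (rule subgroupI)
    show "?Z \<subseteq> carrier G" using Y.subset by blast
    have "\<one> \<in> ?Z" using V.one_closed by simp
    thus "?Z \<noteq> {}" by blast
  next
    fix g assume g: "g \<in> ?Z"
    have gY: "g \<in> Y" using g by blast
    have "f \<otimes> inv g \<otimes> inv f \<otimes> inv (inv g) \<in> V" if f: "f \<in> W" for f
    proof -
      have "f \<otimes> g \<otimes> inv f \<otimes> inv g \<in> V" using g f by blast
      hence "inv g \<otimes> inv (f \<otimes> g \<otimes> inv f \<otimes> inv g) \<otimes> g \<in> V" using gY by (intro V.inv_op_closed1) auto
      also have "inv g \<otimes> inv (f \<otimes> g \<otimes> inv f \<otimes> inv g) \<otimes> g = f \<otimes> inv g \<otimes> inv f \<otimes> inv (inv g)"
        using gY f by (simp add: word_simps)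
      finally show ?thesis .
    qed
    thus "inv g \<in> ?Z" using gY by simp
  next
    fix g h assume g: "g \<in> ?Z" and h: "h \<in> ?Z"
    have gY: "g \<in> Y" and hY: "h \<in> Y" using g h by blast+
    have "f \<otimes> (g \<otimes> h) \<otimes> inv f \<otimes> inv (g \<otimes> h) \<in> V" if f: "f \<in> W" for f
    proof -
      have c: "f \<otimes> g \<otimes> inv f \<otimes> inv g \<in> V" "f \<otimes> h \<otimes> inv f \<otimes> inv h \<in> V" using g h f by blast+
      have c': "g \<otimes> (f \<otimes> h \<otimes> inv f \<otimes> inv h) \<otimes> inv g \<in> V"
        by (rule V.inv_op_closed2[OF Y.mem_carrier[OF gY] c(2)])
      have "(f \<otimes> g \<otimes> inv f \<otimes> inv g) \<otimes> (g \<otimes> (f \<otimes> h \<otimes> inv f \<otimes> inv h) \<otimes> inv g) \<in> V"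
        by (rule V.m_closed[OF c(1) c'])
      also have "(f \<otimes> g \<otimes> inv f \<otimes> inv g) \<otimes> (g \<otimes> (f \<otimes> h \<otimes> inv f \<otimes> inv h) \<otimes> inv g)
          = f \<otimes> (g \<otimes> h) \<otimes> inv f \<otimes> inv (g \<otimes> h)"
        using gY hY f by (simp add: word_simps)
      finally show ?thesis .
    qed
    thus "g \<otimes> h \<in> ?Z" using gY hY by simp
  qed
  show ?thesis
    unfolding normal_inv_iff
  proof (intro conjI sub ballI)
    fix u g assume u: "u \<in> carrier G" and g: "g \<in> ?Z"
    have gY: "g \<in> Y" using g by blast
    have "f \<otimes> (u \<otimes> g \<otimes> inv u) \<otimes> inv f \<otimes> inv (u \<otimes> g \<otimes> inv u) \<in> V" if f: "f \<in> W" for f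
    proof -
      have f': "inv u \<otimes> f \<otimes> u \<in> W" using W.inv_op_closed1 u f by blast
      have "u \<otimes> ((inv u \<otimes> f \<otimes> u) \<otimes> g \<otimes> inv (inv u \<otimes> f \<otimes> u) \<otimes> inv g) \<otimes> inv u \<in> V"
        by (rule V.inv_op_closed2[OF u]) (use f' g in blast)
      also have "u \<otimes> ((inv u \<otimes> f \<otimes> u) \<otimes> g \<otimes> inv (inv u \<otimes> f \<otimes> u) \<otimes> inv g) \<otimes> inv u
          = f \<otimes> (u \<otimes> g \<otimes> inv u) \<otimes> inv f \<otimes> inv (u \<otimes> g \<otimes> inv u)"
        using gY u f by (simp add: word_simps)
      finally show ?thesis .
    qed
    thus "u \<otimes> g \<otimes> inv u \<in> ?Z" using Y.inv_op_closed2[OF u gY] by simp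
  qed
qed

end

context primitive_WSM
begin

text \<open>A normal subgroup \<open>W\<close> of \<open>G\<close> that is abelian modulo \<open>V\<close> meets \<open>M\<close> in an abelian normal subgroup.\<close>
lemma abelian_section:
  assumes W: "W \<lhd> G" and comm: "\<And>a b. a \<in> W \<Longrightarrow> b \<in> W \<Longrightarrow> a \<otimes> b \<otimes> inv a \<otimes> inv b \<in> V"
  shows "subgroup (W \<inter> M) G" and "W \<inter> M \<subseteq> M"
    and "\<And>a b. a \<in> W \<inter> M \<Longrightarrow> b \<in> W \<inter> M \<Longrightarrow> a \<otimes> b = b \<otimes> a"
    and "\<And>m a. m \<in> M \<Longrightarrow> a \<in> W \<inter> M \<Longrightarrow> m \<otimes> a \<otimes> inv m \<in> W \<inter> M"
proof -
  show "subgroup (W \<inter> M) G" by (rule subgroups_Inter_pair[OF normal_imp_subgroup[OF W] M.subgroup_axioms])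
  show "W \<inter> M \<subseteq> M" by blast
  show "a \<otimes> b = b \<otimes> a" if a: "a \<in> W \<inter> M" and b: "b \<in> W \<inter> M" for a b
  proof -
    have aM: "a \<in> M" and bM: "b \<in> M" using a b by blast+
    have "a \<otimes> b \<otimes> inv a \<otimes> inv b \<in> V \<inter> M" using comm a b aM bM by simp
    hence "a \<otimes> b \<otimes> inv a \<otimes> inv b = \<one>" using VM by simp
    hence "a \<otimes> b \<otimes> inv a \<otimes> inv b \<otimes> (b \<otimes> a) = b \<otimes> a" using aM bM by simp
    thus ?thesis using aM bM by (simp add: word_simps)
  qed
  show "m \<otimes> a \<otimes> inv m \<in> W \<inter> M" if m: "m \<in> M" and a: "a \<in> W \<inter> M" for m a
    using normal.inv_op_closed2[OF W, of m a] m a by simp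
qed

text \<open>Every element of the coset \<open>V x\<close> is conjugate to \<open>x\<close> by an element of \<open>V\<close>.\<close>
lemma vanishing_if_fixed_point_free:
  assumes x: "x \<in> carrier G" and free: "\<And>u. u \<in> V \<Longrightarrow> x \<otimes> u = u \<otimes> x \<Longrightarrow> u = \<one>"
  shows "\<not> non_vanishing G x"
proof (rule vanishing_if_coset_conjugate[OF is_group fin one_is_normal V _ x])
  show "{\<one>} \<subset> V" using V_nontrivial V.one_closed by blast
  let ?c = "\<lambda>u. u \<otimes> x \<otimes> inv u \<otimes> inv x"
  have cV: "?c u \<in> V" if "u \<in> V" for u
  proof -
    have "u \<otimes> (x \<otimes> inv u \<otimes> inv x) \<in> V" using that V.inv_op_closed2[OF x] by simp
    thus ?thesis using that x by (simp add: m_assoc)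
  qed
  have inj: "inj_on ?c V"
  proof (rule inj_onI)
    fix u w assume u: "u \<in> V" and w: "w \<in> V" and eq: "?c u = ?c w"
    have G: "u \<in> carrier G" "w \<in> carrier G" using u w by auto
    have "inv w \<otimes> ?c u \<otimes> x \<otimes> u = inv w \<otimes> ?c w \<otimes> x \<otimes> u" using eq by simp
    hence "x \<otimes> (inv w \<otimes> u) = inv w \<otimes> u \<otimes> x" using G x by (simp add: word_simps)
    hence "inv w \<otimes> u = \<one>" using free u w by simp
    hence "w \<otimes> (inv w \<otimes> u) = w" using G by simp
    thus "u = w" using G by (simp add: mult_cancel)
  qed
  have surj: "?c ` V = V" by (rule endo_inj_surj[OF finV image_subsetI[OF cV] inj])
  fix b assume b: "b \<in> V"
  have "b \<in> ?c ` V" unfolding surj by (rule b)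
  then obtain u where u: "b = ?c u" "u \<in> V" by (rule imageE)
  have "u \<otimes> x \<otimes> inv u = \<one> \<otimes> b \<otimes> x"
    unfolding u(1) using V.mem_carrier[OF u(2)] x by (simp add: word_simps)
  thus "\<exists>g\<in>carrier G. \<exists>k\<in>{\<one>}. g \<otimes> x \<otimes> inv g = k \<otimes> b \<otimes> x"
    by (rule bexI[OF bexI[OF _ singletonI] V.mem_carrier[OF u(2)]])
qed

lemma vanishing_if_outside_minimal:
  assumes Y: "Y \<lhd> G" "V \<subseteq> Y" and low: "lower_central G Y n \<subseteq> V" "\<And>i. V \<subseteq> lower_central G Y i"
    and x: "x \<in> Y" "x \<notin> V" and closure: "\<And>L. L \<lhd> G \<Longrightarrow> x \<in> L \<Longrightarrow> Y \<subseteq> L"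
  shows "\<not> non_vanishing G x"
proof -
  interpret Y: normal Y G by (rule Y(1))
  have xG: "x \<in> carrier G" using x(1) by simp
  define k where "k = (LEAST n. lower_central G Y n \<subseteq> V)"
  have k: "lower_central G Y k \<subseteq> V" unfolding k_def by (rule LeastI[of _ n]) (rule low(1))
  have k_min: "\<not> lower_central G Y i \<subseteq> V" if "i < k" for i
    using not_less_Least that unfolding k_def by blast
  have "k \<noteq> 0"
  proof
    assume "k = 0"
    hence "Y \<subseteq> V" using k by simp
    thus False using x by blast
  qed
  then obtain l where l: "k = Suc l" using not0_implies_Suc by blast
  define W where "W = lower_central G Y l"
  have W: "W \<lhd> G" unfolding W_def by (rule lower_central_normal[OF Y(1)])
  have WY: "W \<subseteq> Y" using lower_central_antimono[OF Y(1), of 0 l] by (simp add: W_def)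
  have WcommY: "a \<otimes> b \<otimes> inv a \<otimes> inv b \<in> V" if "a \<in> W" "b \<in> Y" for a b
    using commutator_in_commutator_subgroup[OF that] k unfolding l lower_central_Suc W_def by blast
  have WcommW: "a \<otimes> b \<otimes> inv a \<otimes> inv b \<in> V" if "a \<in> W" "b \<in> W" for a b
    using WcommY that WY by blast
  note A = abelian_section[OF W WcommW]
  note free = abelian_normal_fixed_point_free[OF A]
  have VW: "V \<subseteq> W" unfolding W_def by (rule low(2))
  have part: "\<exists>v\<in>V. \<exists>a\<in>W \<inter> M. w = v \<otimes> a \<and> a \<noteq> \<one>" if w: "w \<in> W" "w \<notin> V" for w
  proof -
    have wG: "w \<in> carrier G" using w(1) WY by auto
    obtain v a where va: "v \<in> V" "a \<in> M" "w = v \<otimes> a" using decompose[OF wG] by blast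
    have "v \<otimes> a \<in> W" using va w by simp
    hence "a \<in> W" using subgroup_mult_mem_iff[OF normal_imp_subgroup[OF W], of v a] va(1,2) VW by auto
    moreover have "a \<noteq> \<one>" using va w by auto
    ultimately show ?thesis using va by blast
  qed
  show ?thesis
  proof (cases l)
    case 0
    have "x \<in> W" using x(1) 0 by (simp add: W_def)
    then obtain v a where va: "v \<in> V" "a \<in> W \<inter> M" "x = v \<otimes> a" "a \<noteq> \<one>" using part x(2) by blast
    have aG: "a \<in> carrier G" using va(2) by simp
    show ?thesis
    proof (rule vanishing_if_fixed_point_free[OF xG])
      fix u assume u: "u \<in> V" and xu: "x \<otimes> u = u \<otimes> x"
      have "v \<otimes> (a \<otimes> u) = (u \<otimes> v) \<otimes> a" using xu va aG u by (simp add: m_assoc)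
      also have "u \<otimes> v = v \<otimes> u" using V_comm u va(1) by blast
      finally have "v \<otimes> (a \<otimes> u) = v \<otimes> (u \<otimes> a)" using va aG u by (simp add: m_assoc)
      hence "a \<otimes> u = u \<otimes> a" using va aG u by simp
      thus "u = \<one>" using free va(2,4) u by blast
    qed
  next
    case (Suc j)
    define F where "F = lower_central G Y j"
    have F: "F \<lhd> G" unfolding F_def by (rule lower_central_normal[OF Y(1)])
    have FY: "F \<subseteq> Y" using lower_central_antimono[OF Y(1), of 0 j] by (simp add: F_def)
    \<comment> \<open>otherwise \<open>x\<close>, and with it all of \<open>Y\<close>, would centralize \<open>F\<close> modulo \<open>V\<close>\<close>
    have "\<exists>f\<in>F. f \<otimes> x \<otimes> inv f \<otimes> inv x \<notin> V"
    proof (rule ccontr)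
      assume "\<not> ?thesis"
      hence "x \<in> {g \<in> Y. \<forall>f\<in>F. f \<otimes> g \<otimes> inv f \<otimes> inv g \<in> V}" using x(1) by blast
      hence "Y \<subseteq> {g \<in> Y. \<forall>f\<in>F. f \<otimes> g \<otimes> inv f \<otimes> inv g \<in> V}"
        by (rule closure[OF commutator_centralizer_normal[OF V F Y(1)]])
      hence "lower_central G Y (Suc j) \<subseteq> V"
        unfolding lower_central_Suc F_def[symmetric]
        by (intro commutator_subgroup_minimal V.subgroup_axioms) blast
      thus False using k_min[of l] l Suc by simp
    qed
    then obtain f where f: "f \<in> F" "f \<otimes> x \<otimes> inv f \<otimes> inv x \<notin> V" by blast
    define z where "z = f \<otimes> x \<otimes> inv f \<otimes> inv x"
    have fY: "f \<in> Y" using f(1) FY by blast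
    have fG: "f \<in> carrier G" using fY by simp
    have zW: "z \<in> W"
      using commutator_in_commutator_subgroup[OF f(1) x(1)] unfolding z_def W_def Suc lower_central_Suc F_def .
    obtain v0 a where va: "v0 \<in> V" "a \<in> W \<inter> M" "z = v0 \<otimes> a" "a \<noteq> \<one>"
      using part[OF zW] f(2) unfolding z_def by blast
    have aM: "a \<in> M" and aW: "a \<in> W" using va(2) by blast+
    have aG: "a \<in> carrier G" using aM by simp
    have powW: "a [^] (i::nat) \<in> W \<inter> M" for i
      using subgroup.one_closed[OF A(1)] subgroup.m_closed[OF A(1)] va(2) by (induction i) auto
    \<comment> \<open>\<open>f\<close> and \<open>a\<close> commute modulo \<open>V\<close>\<close>
    have conj_x: "\<exists>v\<in>V. f [^] i \<otimes> x \<otimes> inv (f [^] i) = v \<otimes> (a [^] i \<otimes> x)" for i :: nat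
    proof (induction i)
      case 0
      show ?case using xG by (intro bexI[of _ \<one>]) auto
    next
      case (Suc i)
      then obtain v where v: "v \<in> V" "f [^] i \<otimes> x \<otimes> inv (f [^] i) = v \<otimes> (a [^] i \<otimes> x)" by blast
      have ai: "a [^] i \<in> W" "a [^] i \<in> carrier G" using powW[of i] aG by auto
      define c where "c = f \<otimes> a [^] i \<otimes> inv f \<otimes> inv (a [^] i)"
      have "inv (a [^] i \<otimes> f \<otimes> inv (a [^] i) \<otimes> inv f) \<in> V" using WcommY[OF ai(1) fY] by simp
      hence c: "c \<in> V" unfolding c_def using ai(2) fG by (simp add: word_simps)
      have v1: "f \<otimes> v \<otimes> inv f \<in> V" "a [^] i \<otimes> v0 \<otimes> inv (a [^] i) \<in> V"
        using V.inv_op_closed2 fG ai(2) v(1) va(1) by blast+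
      have fx: "f \<otimes> x \<otimes> inv f = v0 \<otimes> a \<otimes> x" using va(3) fG xG unfolding z_def
        by (metis inv_closed inv_solve_right m_assoc m_closed)
      have "f [^] Suc i \<otimes> x \<otimes> inv (f [^] Suc i) = f \<otimes> (f [^] i \<otimes> x \<otimes> inv (f [^] i)) \<otimes> inv f"
        unfolding nat_pow_Suc2[OF fG] using fG xG by (simp add: word_simps del: nat_pow_Suc)
      also have "\<dots> = f \<otimes> (v \<otimes> (a [^] i \<otimes> x)) \<otimes> inv f" using v(2) by simp
      also have "\<dots> = (f \<otimes> v \<otimes> inv f) \<otimes> (c \<otimes> a [^] i) \<otimes> (f \<otimes> x \<otimes> inv f)"
        using fG xG ai(2) v(1) by (simp add: c_def word_simps)
      also have "\<dots> = ((f \<otimes> v \<otimes> inv f) \<otimes> c \<otimes> (a [^] i \<otimes> v0 \<otimes> inv (a [^] i))) \<otimes> (a [^] i \<otimes> a \<otimes> x)"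
        unfolding fx using fG xG ai(2) aG v(1) va(1) c by (simp add: word_simps)
      also have "a [^] i \<otimes> a = a [^] Suc i" by simp
      finally show ?case using v1 c by (intro bexI[of _ "(f \<otimes> v \<otimes> inv f) \<otimes> c \<otimes> (a [^] i \<otimes> v0 \<otimes> inv (a [^] i))"]) auto
    qed
    \<comment> \<open>a power of \<open>a\<close> of prime order; the same power of \<open>f\<close> corresponds to it\<close>
    have "ord a \<noteq> 1" using ord_eq_1[OF aG] va(4) by simp
    then obtain q where q: "Factorial_Ring.prime q" "q dvd ord a" using prime_factor_nat by blast
    then obtain s where s: "ord a = q * s" by auto
    have ord_pos: "ord a > 0" using ord_ge_1[OF fin aG] by simp
    define b where "b = a [^] s"
    have b: "b \<in> W \<inter> M" unfolding b_def by (rule powW)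
    have bG: "b \<in> carrier G" using b by simp
    have bq: "b [^] q = \<one>"
      using pow_ord_eq_1[OF aG] aG unfolding b_def s by (simp add: nat_pow_pow mult.commute)
    have b1: "b \<noteq> \<one>"
    proof
      assume "b = \<one>"
      hence "ord a dvd s" using pow_eq_id[OF aG] by (simp add: b_def)
      hence "q * s \<le> s" using s ord_pos by (intro dvd_imp_le) auto
      thus False using prime_gt_1_nat[OF q(1)] s ord_pos by simp
    qed
    let ?C = "generate G {b}"
    have C: "subgroup ?C G" using generate_is_subgroup[of "{b}"] bG by simp
    have CM: "?C \<subseteq> M" by (rule generate_subgroup_incl[OF _ M.subgroup_axioms]) (use b in simp)
    have conj_C: "m \<otimes> c \<otimes> inv m \<in> ?C" if m: "m \<in> M" and c: "c \<in> ?C" for m c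
      by (rule generate_conjugate_closed[OF _ _ _ c])
        (use prime_order_conjugate[OF A b b1 q(1) bq m] m bG in auto)
    define B where "B = V <#> ?C"
    have subB: "subgroup B G" unfolding B_def by (rule mult_norm_subgroup[OF V C])
    have memB: "v \<otimes> c \<in> B" if "v \<in> V" "c \<in> ?C" for v c
      using that unfolding B_def set_mult_def by blast
    have VB: "V \<subseteq> B" and CB: "?C \<subseteq> B"
      using memB[OF _ subgroup.one_closed[OF C]] memB[OF V.one_closed] CM by force+
    have B: "B \<lhd> G"
      unfolding normal_inv_iff
    proof (intro conjI subB ballI)
      fix g d assume g: "g \<in> carrier G" and d: "d \<in> B"
      obtain v m where vm: "v \<in> V" "m \<in> M" "g = v \<otimes> m" using decompose[OF g] by blast
      obtain w c where wc: "w \<in> V" "c \<in> ?C" "d = w \<otimes> c" using d by (auto simp: B_def set_mult_def)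
      have cG: "c \<in> carrier G" using wc(2) CM by auto
      have "g \<otimes> d \<otimes> inv g = (g \<otimes> w \<otimes> inv g) \<otimes> (v \<otimes> (m \<otimes> c \<otimes> inv m) \<otimes> inv v)"
        using vm wc(1,3) cG by (simp add: word_simps)
      moreover have "g \<otimes> w \<otimes> inv g \<in> B" using V.inv_op_closed2[OF g wc(1)] VB by blast
      moreover have "v \<otimes> (m \<otimes> c \<otimes> inv m) \<otimes> inv v \<in> B"
        by (intro subgroup.m_closed[OF subB] subgroup.m_inv_closed[OF subB] subsetD[OF VB vm(1)]
          subsetD[OF CB conj_C[OF vm(2) wc(2)]])
      ultimately show "g \<otimes> d \<otimes> inv g \<in> B" using subgroup.m_closed[OF subB] by simp
    qed
    have bV: "b \<notin> V" using VM b b1 by blast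
    have b_gen: "b \<in> ?C" by (rule generate.incl) simp
    show ?thesis
    proof (rule vanishing_if_coset_conjugate[OF is_group fin V B _ xG])
      show "V \<subset> B" using VB CB bV b_gen by blast
      fix d assume "d \<in> B"
      then obtain w c where wc: "w \<in> V" "c \<in> ?C" "d = w \<otimes> c" by (auto simp: B_def set_mult_def)
      obtain i :: nat where i: "c = b [^] i"
        using wc(2) generate_pow_on_finite_carrier[OF fin bG] by auto
      have c: "c = a [^] (s * i)" using i aG by (simp add: b_def nat_pow_pow)
      have cG: "c \<in> carrier G" using c aG by simp
      obtain v where v: "v \<in> V" "f [^] (s * i) \<otimes> x \<otimes> inv (f [^] (s * i)) = v \<otimes> (c \<otimes> x)"
        using conj_x[of "s * i"] c by auto
      have "v \<otimes> (c \<otimes> x) = (v \<otimes> inv w) \<otimes> d \<otimes> x"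
        using wc(1,3) cG v(1) xG by (simp add: word_simps)
      moreover have "v \<otimes> inv w \<in> V" using v(1) wc(1) by simp
      ultimately show "\<exists>g\<in>carrier G. \<exists>k\<in>V. g \<otimes> x \<otimes> inv g = k \<otimes> d \<otimes> x"
        using v(2) fG by (metis nat_pow_closed)
    qed
  qed
qed

end

text \<open>The hypothesis on normal subgroups \<open>L\<close> says that the last term \<open>V\<close> of the series of \<open>Y\<close> is
  contained in every nontrivial normal subgroup.\<close>
lemma (in group) vanishing_if_residual_minimal:
  assumes fin: "finite (carrier G)" and WSM: "WSM_group G" and solv: "solvable G"
    and Y: "Y \<lhd> G" and x: "x \<in> Y" and closure: "\<And>L. L \<lhd> G \<Longrightarrow> x \<in> L \<Longrightarrow> Y \<subseteq> L"
    and nontriv: "\<And>n. lower_central G Y n \<noteq> {\<one>}"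
    and min: "\<And>L. L \<lhd> G \<Longrightarrow> L \<noteq> {\<one>} \<Longrightarrow> \<exists>n. lower_central G Y n \<subseteq> L"
  shows "\<not> non_vanishing G x"
proof -
  interpret Y: normal Y G by fact
  have low_normal: "lower_central G Y n \<lhd> G" for n by (rule lower_central_normal[OF Y])
  have finlow: "finite (lower_central G Y n)" for n
    using fin finite_subset subgroup.subset[OF normal_imp_subgroup[OF low_normal]] by blast
  obtain k where k: "\<And>n. card (lower_central G Y k) \<le> card (lower_central G Y n)"
    using ex_has_least_nat[of "\<lambda>_. True" 0 "\<lambda>n. card (lower_central G Y n)"] by auto
  define V where "V = lower_central G Y k"
  have stable: "lower_central G Y n = V" if "k \<le> n" for n
    unfolding V_def using card_seteq[OF finlow lower_central_antimono[OF Y that] k] .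
  have V: "V \<lhd> G" unfolding V_def by (rule low_normal)
  have VY: "V \<subseteq> Y" using lower_central_antimono[OF Y, of 0 k] by (simp add: V_def)
  have V1: "V \<noteq> {\<one>}" unfolding V_def by (rule nontriv)
  have Vlow: "V \<subseteq> lower_central G Y n" for n
    using stable[of "max k n"] lower_central_antimono[OF Y, of n "max k n"] by simp
  have Vmin: "V \<subseteq> L" if L: "L \<lhd> G" "L \<noteq> {\<one>}" for L
  proof -
    obtain n where "lower_central G Y n \<subseteq> L" using min[OF L] by blast
    thus ?thesis using Vlow[of n] by (rule order.trans[rotated])
  qed
  have VYV: "commutator_subgroup G V Y = V"
    using stable[of "Suc k"] by (simp add: lower_central_Suc V_def)
  interpret V: normal V G by (rule V)
  have nc: "\<not> (\<forall>v\<in>V. \<forall>y\<in>Y. v \<otimes> y = y \<otimes> v)"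
  proof
    assume c: "\<forall>v\<in>V. \<forall>y\<in>Y. v \<otimes> y = y \<otimes> v"
    have "commutator_subgroup G V Y \<subseteq> {\<one>}"
    proof (rule commutator_subgroup_minimal)
      fix v y assume vy: "v \<in> V" "y \<in> Y"
      have "v \<otimes> y = y \<otimes> v" using c vy by blast
      thus "v \<otimes> y \<otimes> inv v \<otimes> inv y \<in> {\<one>}" using vy by (simp add: word_simps)
    qed (rule normal_imp_subgroup[OF one_is_normal])
    thus False using VYV V1 V.one_closed by auto
  qed
  have comm: "v \<otimes> w = w \<otimes> v" if v: "v \<in> V" and w: "w \<in> V" for v w
  proof -
    have "commutator_subgroup G V V = {\<one>}"
    proof (rule ccontr)
      assume "commutator_subgroup G V V \<noteq> {\<one>}"
      hence "V \<subseteq> commutator_subgroup G V V" by (rule Vmin[OF commutator_subgroup_normal[OF V V]])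
      hence VdV: "V \<subseteq> derived G V" by (simp add: commutator_subgroup_def derived_def)
      have "V \<subseteq> (derived G ^^ n) (carrier G)" for n
      proof (induction n)
        case (Suc n)
        have "derived G V \<subseteq> derived G ((derived G ^^ n) (carrier G))"
          by (rule mono_derived[OF Suc])
        thus ?case using VdV by simp
      qed (use V.subset in simp)
      moreover obtain n where "(derived G ^^ n) (carrier G) = {\<one>}"
        using solv solvable_iff_trivial_derived_seq by blast
      ultimately have "V \<subseteq> {\<one>}" by metis
      thus False using V1 V.one_closed by blast
    qed
    hence "v \<otimes> w \<otimes> inv v \<otimes> inv w = \<one>" using commutator_in_commutator_subgroup[OF v w] by simp
    hence "v \<otimes> w \<otimes> inv v \<otimes> inv w \<otimes> (w \<otimes> v) = w \<otimes> v" using v w by simp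
    thus ?thesis using v w by (simp add: word_simps)
  qed
  have xV: "x \<notin> V"
  proof
    assume "x \<in> V"
    hence "Y \<subseteq> V" by (rule closure[OF V])
    thus False using nc comm by blast
  qed
  obtain M where M: "maximal_in G M (carrier G)" "V \<inter> M = {\<one>}"
    "\<And>g. g \<in> carrier G \<Longrightarrow> \<exists>v\<in>V. \<exists>m\<in>M. g = v \<otimes> m"
  proof (rule maximal_complement[OF fin V V1 _ _ Y VY _ nc, of k], goal_cases)
    case (1 v w)
    show ?case by (rule comm[OF 1(2,3)])
  next
    case (2 L)
    show ?case by (rule Vmin[OF 2(2,3)])
  next
    case 3
    show ?case by (simp add: V_def)
  next
    case (4 M)
    show ?case by (rule 4(1)[OF 4(2-4)])
  qed
  interpret primitive_WSM G V M
    by unfold_locales (use fin WSM V1 comm Vmin M in auto)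
  show ?thesis
    by (rule vanishing_if_outside_minimal[OF Y VY _ Vlow x xV closure, of k]) (simp add: V_def)
qed

theorem theoremA:
  fixes G :: "('a, 'b) monoid_scheme" and x :: 'a
  assumes "group G"
    and "finite (carrier G)"
    and "solvable G"
    and "WSM_group G"
    and "non_vanishing G x"
  shows "x \<in> Fitting G"
proof (rule ccontr)
  assume notin: "x \<notin> Fitting G"
  interpret group G by (rule assms(1))
  have x: "x \<in> carrier G" using assms(5) by (simp add: non_vanishing_def)
  define Y where "Y = generate G ((\<lambda>g. g \<otimes>\<^bsub>G\<^esub> x \<otimes>\<^bsub>G\<^esub> inv\<^bsub>G\<^esub> g) ` carrier G)"
  have Y: "Y \<lhd> G"
    unfolding Y_def
  proof (rule normal_generateI)
    fix h g assume "h \<in> (\<lambda>g. g \<otimes>\<^bsub>G\<^esub> x \<otimes>\<^bsub>G\<^esub> inv\<^bsub>G\<^esub> g) ` carrier G" and g: "g \<in> carrier G"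
    then obtain u where u: "u \<in> carrier G" "h = u \<otimes>\<^bsub>G\<^esub> x \<otimes>\<^bsub>G\<^esub> inv\<^bsub>G\<^esub> u" by blast
    have "g \<otimes>\<^bsub>G\<^esub> h \<otimes>\<^bsub>G\<^esub> inv\<^bsub>G\<^esub> g = (g \<otimes>\<^bsub>G\<^esub> u) \<otimes>\<^bsub>G\<^esub> x \<otimes>\<^bsub>G\<^esub> inv\<^bsub>G\<^esub> (g \<otimes>\<^bsub>G\<^esub> u)"
      using g u x by (simp add: word_simps)
    thus "g \<otimes>\<^bsub>G\<^esub> h \<otimes>\<^bsub>G\<^esub> inv\<^bsub>G\<^esub> g \<in> (\<lambda>g. g \<otimes>\<^bsub>G\<^esub> x \<otimes>\<^bsub>G\<^esub> inv\<^bsub>G\<^esub> g) ` carrier G" using g u by auto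
  qed (use x in auto)
  have xY: "x \<in> Y"
  proof -
    have "x = \<one>\<^bsub>G\<^esub> \<otimes>\<^bsub>G\<^esub> x \<otimes>\<^bsub>G\<^esub> inv\<^bsub>G\<^esub> \<one>\<^bsub>G\<^esub>" using x by simp
    thus ?thesis unfolding Y_def by (intro generate.incl) blast
  qed
  have closure: "Y \<subseteq> L" if L: "L \<lhd> G" "x \<in> L" for L
    unfolding Y_def
    by (rule generate_subgroup_incl[OF _ normal_imp_subgroup[OF L(1)]]) (use normal.inv_op_closed2[OF L(1) _ L(2)] in auto)
  have low_normal: "lower_central G Y n \<lhd> G" for n by (rule lower_central_normal[OF Y])
  have nontriv: "lower_central G Y n \<noteq> {\<one>\<^bsub>G\<^esub>}" for n
  proof
    assume "lower_central G Y n = {\<one>\<^bsub>G\<^esub>}"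
    hence "nilpotent (G\<lparr>carrier := Y\<rparr>)" using nilpotent_restrict_iff[OF Y] by blast
    hence "x \<in> Fitting G" unfolding Fitting_def using Y xY by (intro generate.incl) blast
    thus False using notin by contradiction
  qed
  \<comment> \<open>\<open>N\<close> is chosen maximal among the normal subgroups that contain no term of the series of \<open>Y\<close>\<close>
  define P where "P N \<longleftrightarrow> N \<lhd> G \<and> (\<forall>n. \<not> lower_central G Y n \<subseteq> N)" for N
  have P1: "P {\<one>\<^bsub>G\<^esub>}"
  proof -
    have "\<one>\<^bsub>G\<^esub> \<in> lower_central G Y n" for n by (rule subgroup.one_closed[OF normal_imp_subgroup[OF low_normal]])
    thus ?thesis unfolding P_def using nontriv one_is_normal by blast
  qed
  have Psub: "N \<subseteq> carrier G" if "P N" for N using that unfolding P_def by (blast dest: normal_imp_subgroup subgroup.subset)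
  have "finite (Collect P)" by (rule finite_subset[of _ "Pow (carrier G)"]) (use Psub assms(2) in auto)
  then obtain N where N: "P N" "\<And>N'. P N' \<Longrightarrow> N \<subseteq> N' \<Longrightarrow> N = N'"
    using finite_has_maximal2[of "Collect P" "{\<one>\<^bsub>G\<^esub>}"] P1 by auto
  have NG: "N \<lhd> G" and Nlow: "\<And>n. \<not> lower_central G Y n \<subseteq> N" using N(1) by (auto simp: P_def)
  interpret N: normal N G by (rule NG)
  let ?Q = "G Mod N" and ?\<pi> = "\<lambda>g. N #>\<^bsub>G\<^esub> g"
  have grpQ: "group ?Q" by (rule N.factorgroup_is_group)
  interpret \<pi>: group_hom G ?Q ?\<pi>
    unfolding group_hom_def group_hom_axioms_def
    using is_group grpQ N.r_coset_hom_Mod by blast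
  have surj: "?\<pi> ` carrier G = carrier ?Q" by (simp add: carrier_FactGroup)
  have ker: "g \<in> N" if "g \<in> carrier G" "?\<pi> g = \<one>\<^bsub>?Q\<^esub>" for g
    using that rcos_self[OF that(1) N.subgroup_axioms] by simp
  have YQ: "?\<pi> ` Y \<lhd> ?Q" by (rule normal.surj_hom_normal_subgroup[OF Y \<pi>.group_hom_axioms surj])
  have lowQ: "lower_central ?Q (?\<pi> ` Y) n = ?\<pi> ` lower_central G Y n" for n
    by (rule \<pi>.lower_central_image[OF Y, symmetric])
  have preimage: "{g \<in> carrier G. ?\<pi> g \<in> L} \<lhd> G" if L: "L \<lhd> ?Q" for L
  proof -
    interpret L: normal L ?Q by (rule L)
    have sub: "subgroup {g \<in> carrier G. ?\<pi> g \<in> L} G"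
    proof (rule subgroupI)
      have "\<one>\<^bsub>G\<^esub> \<in> {g \<in> carrier G. ?\<pi> g \<in> L}" using \<pi>.hom_one L.one_closed by simp
      thus "{g \<in> carrier G. ?\<pi> g \<in> L} \<noteq> {}" by blast
    next
      fix a b assume "a \<in> {g \<in> carrier G. ?\<pi> g \<in> L}" "b \<in> {g \<in> carrier G. ?\<pi> g \<in> L}"
      thus "a \<otimes>\<^bsub>G\<^esub> b \<in> {g \<in> carrier G. ?\<pi> g \<in> L}" using \<pi>.hom_mult L.m_closed by simp
    next
      fix a assume "a \<in> {g \<in> carrier G. ?\<pi> g \<in> L}"
      thus "inv\<^bsub>G\<^esub> a \<in> {g \<in> carrier G. ?\<pi> g \<in> L}" using \<pi>.hom_inv L.m_inv_closed by simp
    qed auto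
    show ?thesis
      unfolding normal_inv_iff
    proof (intro conjI sub ballI)
      fix g a assume g: "g \<in> carrier G" and a: "a \<in> {g \<in> carrier G. ?\<pi> g \<in> L}"
      have "?\<pi> (g \<otimes>\<^bsub>G\<^esub> a \<otimes>\<^bsub>G\<^esub> inv\<^bsub>G\<^esub> g) = ?\<pi> g \<otimes>\<^bsub>?Q\<^esub> ?\<pi> a \<otimes>\<^bsub>?Q\<^esub> inv\<^bsub>?Q\<^esub> (?\<pi> g)"
        using g a \<pi>.hom_mult \<pi>.hom_inv by simp
      moreover have "\<dots> \<in> L" by (rule L.inv_op_closed2) (use g a \<pi>.hom_closed in auto)
      ultimately show "g \<otimes>\<^bsub>G\<^esub> a \<otimes>\<^bsub>G\<^esub> inv\<^bsub>G\<^esub> g \<in> {g \<in> carrier G. ?\<pi> g \<in> L}" using g a by simp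
    qed
  qed
  have "\<not> non_vanishing ?Q (?\<pi> x)"
  proof (rule group.vanishing_if_residual_minimal[OF grpQ])
    show "finite (carrier ?Q)" using assms(2) surj by (metis finite_imageI)
    show "WSM_group ?Q" by (rule \<pi>.WSM_group_image[OF surj assms(4)])
    show "solvable ?Q" by (rule \<pi>.surj_hom_imp_solvable[OF surj assms(3)])
    show "?\<pi> ` Y \<lhd> ?Q" by (rule YQ)
    show "?\<pi> x \<in> ?\<pi> ` Y" using xY by blast
    show "?\<pi> ` Y \<subseteq> L" if "L \<lhd> ?Q" "?\<pi> x \<in> L" for L
      using closure[OF preimage[OF that(1)]] that(2) x by blast
    show "lower_central ?Q (?\<pi> ` Y) n \<noteq> {\<one>\<^bsub>?Q\<^esub>}" for n
    proof
      assume "lower_central ?Q (?\<pi> ` Y) n = {\<one>\<^bsub>?Q\<^esub>}"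
      hence "g \<in> N" if "g \<in> lower_central G Y n" for g
        using that ker[of g] subgroup.mem_carrier[OF normal_imp_subgroup[OF low_normal] that] unfolding lowQ by blast
      thus False using Nlow by blast
    qed
    show "\<exists>n. lower_central ?Q (?\<pi> ` Y) n \<subseteq> L" if L: "L \<lhd> ?Q" "L \<noteq> {\<one>\<^bsub>?Q\<^esub>}" for L
    proof (rule ccontr)
      assume neg: "\<not> ?thesis"
      let ?L = "{g \<in> carrier G. ?\<pi> g \<in> L}"
      have one: "\<one>\<^bsub>?Q\<^esub> \<in> L" by (rule subgroup.one_closed[OF normal_imp_subgroup[OF L(1)]])
      have "P ?L" unfolding P_def
      proof (intro conjI preimage[OF L(1)] allI notI)
        fix n assume "lower_central G Y n \<subseteq> ?L"
        hence "lower_central ?Q (?\<pi> ` Y) n \<subseteq> L" unfolding lowQ by blast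
        thus False using neg by blast
      qed
      moreover have "N \<subseteq> ?L"
      proof
        fix g assume g: "g \<in> N"
        have "?\<pi> g = \<one>\<^bsub>?Q\<^esub>" using coset_join2[OF _ N.subgroup_axioms g] g by simp
        thus "g \<in> ?L" using one g by simp
      qed
      ultimately have eq: "N = ?L" by (rule N(2))
      have "C = \<one>\<^bsub>?Q\<^esub>" if C: "C \<in> L" for C
      proof -
        have "C \<in> carrier ?Q" using C subgroup.subset[OF normal_imp_subgroup[OF L(1)]] by blast
        then obtain g where g: "g \<in> carrier G" "C = ?\<pi> g" using surj by blast
        hence "g \<in> N" using C eq by blast
        thus ?thesis using coset_join2[OF g(1) N.subgroup_axioms] g by simp
      qed
      thus False using one L(2) by blast
    qed
  qed
  thus False using \<pi>.non_vanishing_image[OF surj assms(5)] by contradiction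
qed

end
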